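(* Let $n\in\mathbb{N}$, let $A$ be a (bounded) normal operator and $B$ an operator of norm one, both acting on a complex Hilbert space $H$. Put $$\Gamma=\{(x,y,z_1,z_2)\in\mathbb{C}^4: x^n+y^n+(-1)^{n-1}(e^{2\pi i/n}z_1+z_2)^n=1\},$$ $$\tilde\tau_{1j}=(e^{2\pi ji/n},0,0,0),\quad \tilde\tau_{2j}=(0,e^{2\pi ji/n},0,0),\quad j=0,\dots,n-1.$$ Suppose there exists $\epsilon>0$ such that: 1) $\sigma_p(A,B,AB,BA)\cap\Delta_4(\tilde\tau_{mj},\epsilon)=\Gamma\cap\Delta_4(\tilde\tau_{mj},\epsilon)$ for $m=1,2$, $j=0,\dots,n-1$; 2) the multiplicity in $\sigma_p(A,B,AB,BA)$ of each point of $\Gamma\cap\Delta_4(\tilde\tau_{mj},\epsilon)$, $m=1,2$, $j=0,\dots,n-1$, is equal to one. Then: 1) There is a subspace $L\subset H$ of dimension $n$ invariant under the action of $A$ and $B$. 2) The restriction of the pair $(A,B)$ to the subspace $L$ is unitarily equivalent to $$\begin{bmatrix}1&0&\cdots&0\\0&e^{2\pi i/n}&\cdots&0\\ \vdots&&\ddots&\vdots\\0&0&\cdots&e^{2\pi(n-1)i/n}\end{bmatrix},\qquad \begin{bmatrix}0&0&0&\cdots&1\\1&0&0&\cdots&0\\0&1&0&\cdots&0\\ \vdots&&\ddots&&\vdots\\0&0&\cdots&1&0\end{bmatrix},$$ and, for orthonormal eigenbases $e_0,\dots,e_{n-1}$ of $A|_L$ and $\zeta_0,\dots,\zeta_{n-1}$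 of $B|_L$ with $Ae_j=e^{2\pi ji/n}e_j$, $B\zeta_j=e^{2\pi ji/n}\zeta_j$, $\sqrt n$ times the transition matrix from $\{e_0,\dots,e_{n-1}\}$ to $\{\zeta_0,\dots,\zeta_{n-1}\}$ is of the form $\Lambda_1F_n\Lambda_2$, where $\Lambda_1,\Lambda_2$ are diagonal matrices with unimodular entries on the main diagonal.
   Context: For bounded operators $A_1,\dots,A_k$ on $H$, $\sigma_p(A_1,\dots,A_k)=\{(x_1,\dots,x_k)\in\mathbb{C}^k: x_1A_1+\dots+x_kA_k-I \text{ is not invertible}\}$. $\Delta_k(x,\rho)=\{w\in\mathbb{C}^k: |w_j-x_j|<\rho,\ j=1,\dots,k\}$ is the polydisk. Multiplicity one: a point $x\in\sigma_p(A_1,\dots,A_k)$ has multiplicity one if $1$ is an isolated point of the spectrum of $A(x)=x_1A_1+\dots+x_kA_k$ and the Riesz projection $\frac{1}{2\pi i}\int_{|w-1|=\rho}(w-A(x))^{-1}dw$ (for small $\rho>0$) has rank one. $F_n=[e^{2\pi i(k-1)(j-1)/n}]_{j,k=1}^n$ is the Fourier matrix. The transition matrix from $\{e_r\}$ to $\{\zeta_j\}$ is the matrix whose $r$-th column is $(c_{r0},\dots,c_{r\,n-1})^T$, where $e_r=\sum_jc_{rj}\zeta_j$. Unitary equivalence of pairs means simultaneous equivalence by a single unitary operator. *)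

theory Defs
  imports
    "HOL-Complex_Analysis.Complex_Analysis"
    "Jordan_Normal_Form.Matrix"
begin

hide_const (open) Finite_Cartesian_Product.vec
unbundle no vec_syntax

section \<open>Complex Hilbert spaces\<close>

text \<open>
  The inner product is linear in the first argument, as is \<open>v \<bullet>c w\<close> on coordinate vectors.
  Positive definiteness of \<open>cinner\<close> follows from \<open>cinner_self\<close> and the norm axioms.
\<close>

class complex_inner = real_normed_vector +
  fixes scaleC :: "complex \<Rightarrow> 'a \<Rightarrow> 'a" (infixr \<open>*\<^sub>C\<close> 75)
    and cinner :: "'a \<Rightarrow> 'a \<Rightarrow> complex"
  assumes scaleC_add_right: "c *\<^sub>C (x + y) = c *\<^sub>C x + c *\<^sub>C y"
    and scaleC_add_left: "(c + d) *\<^sub>C x = c *\<^sub>C x + d *\<^sub>C x"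
    and scaleC_scaleC: "c *\<^sub>C d *\<^sub>C x = (c * d) *\<^sub>C x"
    and scaleC_of_real: "complex_of_real r *\<^sub>C x = r *\<^sub>R x"
    and cinner_commute: "cinner x y = cnj (cinner y x)"
    and cinner_add_left: "cinner (x + y) z = cinner x z + cinner y z"
    and cinner_scaleC_left: "cinner (c *\<^sub>C x) y = c * cinner x y"
    and cinner_self: "cinner x x = complex_of_real ((norm x)\<^sup>2)"

class chilbert_space = complex_inner + complete_space
begin
subclass banach ..
end

interpretation complex_vector:
  vector_space "scaleC :: complex \<Rightarrow> 'a \<Rightarrow> 'a::complex_inner"
proof
  show "1 *\<^sub>C x = x" for x :: 'a
    using scaleC_of_real[of 1 x] by simp
qed (simp_all add: scaleC_add_right scaleC_add_left scaleC_scaleC)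

lemma norm_scaleC: "norm (c *\<^sub>C (x :: 'a::complex_inner)) = cmod c * norm x"
proof -
  have "complex_of_real ((norm (c *\<^sub>C x))\<^sup>2) = c * cnj c * cinner x x"
    using cinner_self[of "c *\<^sub>C x"] cinner_commute[of x "c *\<^sub>C x"] cinner_commute[of x x]
    by (simp add: cinner_scaleC_left mult.assoc)
  also have "\<dots> = complex_of_real ((cmod c * norm x)\<^sup>2)"
    by (simp only: cinner_self complex_norm_square[symmetric] power_mult_distrib of_real_mult)
  finally show ?thesis
    unfolding of_real_eq_iff by (simp add: power2_eq_iff_nonneg)
qed


section \<open>Bounded operators\<close>

text \<open>
  A bounded operator on a complex Hilbert space is an element of \<open>'a \<Rightarrow>\<^sub>L 'a\<close>
  (bounded and real-linear, with the operator norm) that satisfies \<open>clinear_op\<close>.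
  Real-linear inverses of complex-linear operators are complex-linear.
\<close>

definition clinear_op :: "('a::complex_inner \<Rightarrow>\<^sub>L 'a) \<Rightarrow> bool" where
  "clinear_op T \<longleftrightarrow> (\<forall>c x. blinfun_apply T (c *\<^sub>C x) = c *\<^sub>C blinfun_apply T x)"

lift_definition scale_op :: "complex \<Rightarrow> ('a::complex_inner \<Rightarrow>\<^sub>L 'a) \<Rightarrow> ('a \<Rightarrow>\<^sub>L 'a)"
  is "\<lambda>c T x. c *\<^sub>C T x"
proof -
  fix c :: complex and T :: "'a \<Rightarrow> 'a"
  assume T: "bounded_linear T"
  have "bounded_linear (\<lambda>x::'a. c *\<^sub>C x)"
  proof (rule bounded_linear_intro)
    fix r :: real and x :: 'a
    show "c *\<^sub>C r *\<^sub>R x = r *\<^sub>R c *\<^sub>C x"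
      by (simp flip: scaleC_of_real add: scaleC_scaleC mult.commute)
    show "norm (c *\<^sub>C x) \<le> norm x * cmod c"
      by (simp add: norm_scaleC)
  qed (simp add: scaleC_add_right)
  from bounded_linear_compose[OF this T] show "bounded_linear (\<lambda>x. c *\<^sub>C T x)" .
qed

definition is_adjoint :: "('a::complex_inner \<Rightarrow>\<^sub>L 'a) \<Rightarrow> ('a \<Rightarrow>\<^sub>L 'a) \<Rightarrow> bool" where
  "is_adjoint T S \<longleftrightarrow>
     (\<forall>x y. cinner (blinfun_apply T x) y = cinner x (blinfun_apply S y))"

definition normal_op :: "('a::complex_inner \<Rightarrow>\<^sub>L 'a) \<Rightarrow> bool" where
  "normal_op T \<longleftrightarrow> (\<exists>S. is_adjoint T S \<and> T o\<^sub>L S = S o\<^sub>L T)"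

definition is_inverse_op :: "('a::real_normed_vector \<Rightarrow>\<^sub>L 'a) \<Rightarrow> ('a \<Rightarrow>\<^sub>L 'a) \<Rightarrow> bool" where
  "is_inverse_op T S \<longleftrightarrow> T o\<^sub>L S = id_blinfun \<and> S o\<^sub>L T = id_blinfun"

definition invertible_op :: "('a::real_normed_vector \<Rightarrow>\<^sub>L 'a) \<Rightarrow> bool" where
  "invertible_op T \<longleftrightarrow> (\<exists>S. is_inverse_op T S)"

definition inverse_op :: "('a::real_normed_vector \<Rightarrow>\<^sub>L 'a) \<Rightarrow> ('a \<Rightarrow>\<^sub>L 'a)" where
  "inverse_op T = (THE S. is_inverse_op T S)"

definition spectrum_op :: "('a::complex_inner \<Rightarrow>\<^sub>L 'a) \<Rightarrow> complex set" where
  "spectrum_op T = {w. \<not> invertible_op (scale_op w id_blinfun - T)}"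

text \<open>
  Operator-valued analogue of \<open>contour_integral\<close>; the integral is taken in the Banach space
  of bounded operators.
\<close>

definition contour_integral_op ::
    "(real \<Rightarrow> complex) \<Rightarrow> (complex \<Rightarrow> 'a::complex_inner \<Rightarrow>\<^sub>L 'a) \<Rightarrow> ('a \<Rightarrow>\<^sub>L 'a)" where
  "contour_integral_op g f =
     integral {0..1} (\<lambda>t. scale_op (vector_derivative g (at t within {0..1})) (f (g t)))"

definition riesz_projection ::
    "('a::complex_inner \<Rightarrow>\<^sub>L 'a) \<Rightarrow> complex \<Rightarrow> real \<Rightarrow> ('a \<Rightarrow>\<^sub>L 'a)" where
  "riesz_projection T z \<rho> =
     scale_op (1 / (2 * complex_of_real pi * \<i>))
       (contour_integral_op (circlepath z \<rho>) (\<lambda>w. inverse_op (scale_op w id_blinfun - T)))"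

text \<open>
  \<open>complex_vector.dim\<close> is \<open>0\<close> on infinite-dimensional spaces, so rank one excludes infinite rank.
\<close>

definition rank_one :: "('a::complex_inner \<Rightarrow>\<^sub>L 'a) \<Rightarrow> bool" where
  "rank_one T \<longleftrightarrow> complex_vector.dim (range (blinfun_apply T)) = 1"


section \<open>Projective joint spectrum\<close>

definition pencil :: "('a::complex_inner \<Rightarrow>\<^sub>L 'a) list \<Rightarrow> complex vec \<Rightarrow> ('a \<Rightarrow>\<^sub>L 'a)" where
  "pencil As x = (\<Sum>j<length As. scale_op (x $ j) (As ! j))"

definition sigma_p :: "('a::complex_inner \<Rightarrow>\<^sub>L 'a) list \<Rightarrow> complex vec set" where
  "sigma_p As =
     {x \<in> carrier_vec (length As). \<not> invertible_op (pencil As x - id_blinfun)}"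

definition multiplicity_one :: "('a::complex_inner \<Rightarrow>\<^sub>L 'a) list \<Rightarrow> complex vec \<Rightarrow> bool" where
  "multiplicity_one As x \<longleftrightarrow>
     x \<in> sigma_p As \<and> 1 isolated_in spectrum_op (pencil As x) \<and>
     (\<forall>\<^sub>F \<rho> in at_right 0. rank_one (riesz_projection (pencil As x) 1 \<rho>))"

definition polydisk :: "complex vec \<Rightarrow> real \<Rightarrow> complex vec set" where
  "polydisk x \<rho> = {w \<in> carrier_vec (dim_vec x). \<forall>j<dim_vec x. cmod (w $ j - x $ j) < \<rho>}"

definition Gamma_set :: "nat \<Rightarrow> complex vec set" where
  "Gamma_set n = {vec_of_list [x, y, z\<^sub>1, z\<^sub>2] | x y z\<^sub>1 z\<^sub>2.
     x ^ n + y ^ n + (-1) ^ (n - 1) * (cis (2 * pi / n) * z\<^sub>1 + z\<^sub>2) ^ n = 1}"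

definition tau1 :: "nat \<Rightarrow> nat \<Rightarrow> complex vec" where
  "tau1 n j = vec_of_list [cis (2 * pi * j / n), 0, 0, 0]"

definition tau2 :: "nat \<Rightarrow> nat \<Rightarrow> complex vec" where
  "tau2 n j = vec_of_list [0, cis (2 * pi * j / n), 0, 0]"


section \<open>Unitary equivalence and transition matrices\<close>

definition unitary_onto :: "nat \<Rightarrow> 'a::complex_inner set \<Rightarrow> (complex vec \<Rightarrow> 'a) \<Rightarrow> bool" where
  "unitary_onto n L U \<longleftrightarrow>
     (\<forall>v\<in>carrier_vec n. \<forall>w\<in>carrier_vec n. U (v + w) = U v + U w) \<and>
     (\<forall>c. \<forall>v\<in>carrier_vec n. U (c \<cdot>\<^sub>v v) = c *\<^sub>C U v) \<and>
     (\<forall>v\<in>carrier_vec n. \<forall>w\<in>carrier_vec n. cinner (U v) (U w) = v \<bullet>c w) \<and>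
     U ` carrier_vec n = L"

text \<open>
  The restriction of \<open>(A, B)\<close> to the invariant subspace \<open>L\<close> is unitarily equivalent to the
  pair \<open>(M, N)\<close> of \<open>n \<times> n\<close> matrices acting on column vectors.
\<close>

definition restriction_unitarily_equivalent ::
    "nat \<Rightarrow> 'a::complex_inner set \<Rightarrow> ('a \<Rightarrow>\<^sub>L 'a) \<Rightarrow> ('a \<Rightarrow>\<^sub>L 'a) \<Rightarrow>
     complex mat \<Rightarrow> complex mat \<Rightarrow> bool" where
  "restriction_unitarily_equivalent n L A B M N \<longleftrightarrow>
     (\<exists>U. unitary_onto n L U \<and>
        (\<forall>v\<in>carrier_vec n. blinfun_apply A (U v) = U (M *\<^sub>v v)) \<and>
        (\<forall>v\<in>carrier_vec n. blinfun_apply B (U v) = U (N *\<^sub>v v)))"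

definition clock_mat :: "nat \<Rightarrow> complex mat" where
  "clock_mat n = mat n n (\<lambda>(i, j). if i = j then cis (2 * pi * i / n) else 0)"

definition shift_mat :: "nat \<Rightarrow> complex mat" where
  "shift_mat n = mat n n (\<lambda>(i, j). if i = (j + 1) mod n then 1 else 0)"

text \<open>Rows and columns are indexed from \<open>0\<close>.\<close>

definition fourier_mat :: "nat \<Rightarrow> complex mat" where
  "fourier_mat n = mat n n (\<lambda>(j, k). cis (2 * pi * (real k * real j) / n))"

definition orthonormal_basis_of :: "nat \<Rightarrow> 'a::complex_inner set \<Rightarrow> (nat \<Rightarrow> 'a) \<Rightarrow> bool" where
  "orthonormal_basis_of n L e \<longleftrightarrow>
     (\<forall>i<n. \<forall>j<n. cinner (e i) (e j) = (if i = j then 1 else 0)) \<and>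
     complex_vector.span (e ` {..<n}) = L"

definition orthonormal_eigenbasis ::
    "nat \<Rightarrow> 'a::complex_inner set \<Rightarrow> ('a \<Rightarrow>\<^sub>L 'a) \<Rightarrow> (nat \<Rightarrow> 'a) \<Rightarrow> bool" where
  "orthonormal_eigenbasis n L T e \<longleftrightarrow>
     orthonormal_basis_of n L e \<and>
     (\<forall>j<n. blinfun_apply T (e j) = cis (2 * pi * j / n) *\<^sub>C e j)"

text \<open>Column \<open>r\<close> of the transition matrix holds the coordinates of \<open>e r\<close> with respect to \<open>\<zeta>\<close>.\<close>

definition is_transition_mat ::
    "nat \<Rightarrow> (nat \<Rightarrow> 'a::complex_inner) \<Rightarrow> (nat \<Rightarrow> 'a) \<Rightarrow> complex mat \<Rightarrow> bool" where
  "is_transition_mat n e \<zeta> C \<longleftrightarrow>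
     C \<in> carrier_mat n n \<and> (\<forall>r<n. e r = (\<Sum>j<n. (C $$ (j, r)) *\<^sub>C \<zeta> j))"

definition unimodular_diagonal :: "nat \<Rightarrow> complex mat \<Rightarrow> bool" where
  "unimodular_diagonal n D \<longleftrightarrow>
     D \<in> carrier_mat n n \<and> diagonal_mat D \<and> (\<forall>i<n. cmod (D $$ (i, i)) = 1)"

end

theory Submission
  imports Defs
begin

text \<open>
  Write \<open>\<omega> = exp (2 \<pi> i / n)\<close>, let \<open>d\<^sup>n = 1\<close> and \<open>T = d A\<close>. The points of \<open>\<Gamma>\<close> close to \<open>(d, 0, 0, 0)\<close>
  describe how the eigenvalue \<open>1\<close> of \<open>T\<close> moves when multiples of \<open>B\<close>, \<open>A B\<close> and \<open>B A\<close> are added to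
  \<open>T\<close>. The multiplicity hypothesis makes this eigenvalue simple and isolated, and normality makes
  its eigenvector \<open>p\<close> span a reducing subspace, so that the first order motion in a direction \<open>W\<close>
  is \<open>\<langle>W p, p\<rangle>\<close> (\<open>multiplicity_one_simple_fixed_vector\<close>, \<open>simple_fixed_vector_first_order\<close>).

  The products \<open>A B\<close> and \<open>B A\<close> enter through a factorization. The pencil contains the family
  \<open>(r T - I) (I - s B)\<close>, whose second factor is invertible for small \<open>s\<close>. Adding \<open>t B\<close> or \<open>t B A\<close>
  and dividing by that factor perturbs \<open>T\<close> in the direction \<open>B (I - s B)\<^sup>-\<^sup>1\<close> or
  \<open>B A (I - s B)\<^sup>-\<^sup>1\<close>: one derivative along \<open>\<Gamma>\<close>, taken for every small \<open>s\<close>, yields the generating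
  function of all \<open>\<langle>B\<^sup>m p, p\<rangle>\<close> or \<open>\<langle>B A B\<^sup>m p, p\<rangle>\<close>. The equation of \<open>\<Gamma>\<close> evaluates both to a
  multiple of \<open>s ^ (n - 1) / (1 - s ^ n)\<close>. The coefficient of \<open>s ^ (n - 1)\<close> says that
  \<open>\<langle>B\<^sup>n p, p\<rangle> = 1\<close> and \<open>\<omega> d \<langle>B A B\<^sup>m p, p\<rangle> = 1\<close> for \<open>m = n - 1\<close> (\<open>surface_determines_moments\<close>).

  Because \<open>B\<close> is a contraction, the first identity forces \<open>B\<^sup>n p = p\<close>. So the \<open>n\<close> orthonormal
  eigenvectors \<open>p\<close> obtained for the different \<open>d\<close> lie in the sum of the eigenspaces of \<open>B\<close> for the
  \<open>n\<close>-th roots of unity. These are lines by the multiplicity hypothesis at the points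
  \<open>(0, d, 0, 0)\<close>, hence the sum is the span \<open>L\<close> of the vectors \<open>p\<close>, on which \<open>A\<close> and \<open>B\<close> are
  unitary. The second identity now is a case of equality in Cauchy--Schwarz and shows that the
  preimage of \<open>p\<close> under \<open>B\<close> in \<open>L\<close> is an eigenvector of \<open>A\<close> with eigenvalue \<open>1 / (\<omega> d)\<close>. Thus
  \<open>B\<close> permutes the eigenlines of \<open>A\<close> cyclically, and the orbit of one eigenvector under \<open>B\<close> is a
  basis in which \<open>A\<close> and \<open>B\<close> are the clock and the shift (\<open>clock_shift_orbit\<close>). The Fourier
  matrix is the change from this basis to the eigenbasis of the shift.
\<close>

section \<open>Inner products\<close>

lemma cinner_add_right: "cinner x (y + z) = cinner x y + cinner x (z :: 'a::complex_inner)"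
  by (metis cinner_add_left cinner_commute complex_cnj_add)

lemma cinner_scaleC_right: "cinner x (c *\<^sub>C y) = cnj c * cinner x (y :: 'a::complex_inner)"
  by (metis cinner_commute cinner_scaleC_left complex_cnj_mult)

lemma cinner_zero_left [simp]: "cinner 0 (x :: 'a::complex_inner) = 0"
  using cinner_add_left[of 0 0 x] by simp

lemma cinner_zero_right [simp]: "cinner (x :: 'a::complex_inner) 0 = 0"
  using cinner_add_right[of x 0 0] by simp

lemma cinner_minus_left: "cinner (- x) y = - cinner x (y :: 'a::complex_inner)"
  using cinner_add_left[of x "- x" y] by (simp add: eq_neg_iff_add_eq_0 add.commute)

lemma cinner_minus_right: "cinner x (- y) = - cinner x (y :: 'a::complex_inner)"
  using cinner_add_right[of x y "- y"] by (simp add: eq_neg_iff_add_eq_0 add.commute)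

lemma cinner_diff_left: "cinner (x - y) z = cinner x z - cinner y (z :: 'a::complex_inner)"
  using cinner_add_left[of x "- y" z] by (simp add: cinner_minus_left)

lemma cinner_diff_right: "cinner x (y - z) = cinner x y - cinner x (z :: 'a::complex_inner)"
  using cinner_add_right[of x y "- z"] by (simp add: cinner_minus_right)

lemma cinner_sum_left: "cinner (sum f I) y = (\<Sum>i\<in>I. cinner (f i) (y :: 'a::complex_inner))"
  by (induction I rule: infinite_finite_induct) (simp_all add: cinner_add_left)

lemma cinner_sum_right: "cinner y (sum f I) = (\<Sum>i\<in>I. cinner y (f i :: 'a::complex_inner))"
  by (induction I rule: infinite_finite_induct) (simp_all add: cinner_add_right)

lemma cinner_eq_zero_iff [simp]: "cinner x x = 0 \<longleftrightarrow> x = (0 :: 'a::complex_inner)"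
  by (simp add: cinner_self)

lemma norm_diff_squared:
  "(norm (x - y))\<^sup>2 = (norm x)\<^sup>2 - 2 * Re (cinner x y) + (norm (y :: 'a::complex_inner))\<^sup>2"
proof -
  have "complex_of_real ((norm (x - y))\<^sup>2)
      = of_real ((norm x)\<^sup>2) - (cinner x y + cnj (cinner x y)) + of_real ((norm y)\<^sup>2)"
    by (simp add: cinner_self[symmetric] cinner_commute[of y x] cinner_diff_left cinner_diff_right
        del: of_real_power)
  also have "\<dots> = of_real ((norm x)\<^sup>2 - 2 * Re (cinner x y) + (norm y)\<^sup>2)"
    by (simp only: complex_add_cnj of_real_add of_real_diff)
  finally show ?thesis by (simp only: of_real_eq_iff)
qed

lemma cauchy_schwarz: "cmod (cinner x y) \<le> norm x * norm (y :: 'a::complex_inner)"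
proof (cases "y = 0")
  case False
  define c where "c = cinner x y / of_real ((norm y)\<^sup>2)"
  have "cinner x (c *\<^sub>C y) = cinner x y * cnj (cinner x y) / of_real ((norm y)\<^sup>2)"
    by (simp add: c_def cinner_scaleC_right mult.commute)
  also have "\<dots> = of_real ((cmod (cinner x y))\<^sup>2 / (norm y)\<^sup>2)"
    by (simp only: complex_norm_square[symmetric] of_real_divide of_real_power)
  finally have Re: "Re (cinner x (c *\<^sub>C y)) = (cmod (cinner x y))\<^sup>2 / (norm y)\<^sup>2"
    by (simp only: Re_complex_of_real)
  have "(norm (c *\<^sub>C y))\<^sup>2 = (cmod (cinner x y))\<^sup>2 / (norm y)\<^sup>2"
    using False by (simp add: norm_scaleC c_def norm_divide norm_power power_mult_distrib
        power_divide)
       (simp add: power2_eq_square power4_eq_xxxx)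
  then have "0 \<le> (norm x)\<^sup>2 - (cmod (cinner x y))\<^sup>2 / (norm y)\<^sup>2"
    using norm_diff_squared[of x "c *\<^sub>C y"] Re zero_le_power2[of "norm (x - c *\<^sub>C y)"] by linarith
  then have "(cmod (cinner x y))\<^sup>2 \<le> (norm x * norm y)\<^sup>2"
    using False by (simp add: field_simps power_mult_distrib)
  then show ?thesis by (rule power2_le_imp_le) simp
qed simp

text \<open>Equality in Cauchy--Schwarz, in the form in which all extremal vectors below are found.\<close>

lemma cinner_extremal:
  fixes u v :: "'a::complex_inner"
  assumes "cinner u v = c" "cmod c = 1" "norm u \<le> 1" "norm v = 1"
  shows "u = c *\<^sub>C v"
proof -
  have "cinner u (c *\<^sub>C v) = complex_of_real ((cmod c)\<^sup>2)"
    by (simp only: cinner_scaleC_right assms(1) complex_norm_square mult.commute)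
  then have "Re (cinner u (c *\<^sub>C v)) = 1"
    using assms(2) by simp
  then have "(norm (u - c *\<^sub>C v))\<^sup>2 \<le> 0"
    using assms power_le_one[of "norm u" 2] by (simp add: norm_diff_squared norm_scaleC)
  then show ?thesis by simp
qed

lemma bounded_bilinear_cinner: "bounded_bilinear (cinner :: 'a::complex_inner \<Rightarrow> 'a \<Rightarrow> complex)"
proof
  fix r :: real and a b :: 'a
  show "cinner (r *\<^sub>R a) b = r *\<^sub>R cinner a b" "cinner a (r *\<^sub>R b) = r *\<^sub>R cinner a b"
    by (simp_all add: scaleC_of_real[symmetric] cinner_scaleC_left cinner_scaleC_right scaleR_conv_of_real)
  show "\<exists>K. \<forall>a b :: 'a. norm (cinner a b) \<le> norm a * norm b * K"
    by (rule exI[of _ 1]) (simp add: cauchy_schwarz)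
qed (simp_all add: cinner_add_left cinner_add_right)

lemmas tendsto_cinner = bounded_bilinear.tendsto[OF bounded_bilinear_cinner]

lemma scaleC_scaleR: "r *\<^sub>R c *\<^sub>C x = c *\<^sub>C r *\<^sub>R (x :: 'a::complex_inner)"
  by (simp flip: scaleC_of_real add: scaleC_scaleC mult.commute)

lemma bounded_bilinear_scaleC:
  "bounded_bilinear (scaleC :: complex \<Rightarrow> 'a \<Rightarrow> 'a::complex_inner)"
proof
  fix r :: real and c :: complex and b :: 'a
  show "(r *\<^sub>R c) *\<^sub>C b = r *\<^sub>R c *\<^sub>C b" "c *\<^sub>C (r *\<^sub>R b) = r *\<^sub>R c *\<^sub>C b"
    by (simp_all add: scaleC_of_real[symmetric] scaleC_scaleC scaleR_conv_of_real mult.commute)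
  show "\<exists>K. \<forall>a (b :: 'a). norm (a *\<^sub>C b) \<le> norm a * norm b * K"
    by (rule exI[of _ 1]) (simp add: norm_scaleC)
qed (simp_all add: scaleC_add_left scaleC_add_right)

lemma scaleC_minus_left: "(a - b) *\<^sub>C v = a *\<^sub>C v - b *\<^sub>C (v :: 'a::complex_inner)"
  by (rule complex_vector.scale_left_diff_distrib)


section \<open>Bounded operators\<close>

lemma scale_op_apply [simp]: "blinfun_apply (scale_op c T) v = c *\<^sub>C blinfun_apply T v"
  by (simp add: scale_op.rep_eq)

lemma clinear_op_scaleC: "clinear_op T \<Longrightarrow> blinfun_apply T (c *\<^sub>C v) = c *\<^sub>C blinfun_apply T v"
  by (simp add: clinear_op_def)

lemma norm_scale_op_le: "norm (scale_op c T) \<le> cmod c * norm (T :: 'a::complex_inner \<Rightarrow>\<^sub>L 'a)"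
  by (rule norm_blinfun_bound)
     (auto simp: norm_scaleC mult.assoc intro!: mult_left_mono norm_blinfun)

lemma bounded_bilinear_scale_op:
  "bounded_bilinear (scale_op :: complex \<Rightarrow> ('a::complex_inner \<Rightarrow>\<^sub>L 'a) \<Rightarrow> _)"
proof
  fix r :: real and a :: complex and b :: "'a \<Rightarrow>\<^sub>L 'a"
  show "scale_op (r *\<^sub>R a) b = r *\<^sub>R scale_op a b" "scale_op a (r *\<^sub>R b) = r *\<^sub>R scale_op a b"
    by (auto intro!: blinfun_eqI simp: blinfun.scaleR_left
        bounded_bilinear.scaleR_left[OF bounded_bilinear_scaleC]
        bounded_bilinear.scaleR_right[OF bounded_bilinear_scaleC])
  show "\<exists>K. \<forall>a (b :: 'a \<Rightarrow>\<^sub>L 'a). norm (scale_op a b) \<le> norm a * norm b * K"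
    by (rule exI[of _ 1]) (simp add: norm_scale_op_le)
qed (auto intro!: blinfun_eqI simp: blinfun.add_left scaleC_add_left scaleC_add_right)

lemma clinear_op_shift: "clinear_op T \<Longrightarrow> clinear_op (scale_op w id_blinfun - T)"
  by (simp add: clinear_op_def blinfun.diff_left scaleC_scaleC mult.commute
      complex_vector.scale_right_diff_distrib)

lemma is_inverse_op_iff:
  "is_inverse_op T S \<longleftrightarrow> (\<forall>v. blinfun_apply T (blinfun_apply S v) = v) \<and>
     (\<forall>v. blinfun_apply S (blinfun_apply T v) = v)"
  unfolding is_inverse_op_def
  by (metis blinfun_apply_blinfun_compose blinfun_eqI id_blinfun.rep_eq)

lemma is_inverse_op_unique: "is_inverse_op T S \<Longrightarrow> is_inverse_op T S' \<Longrightarrow> S = S'"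
  by (intro blinfun_eqI) (metis is_inverse_op_iff)

lemma inverse_op_eq: "is_inverse_op T S \<Longrightarrow> inverse_op T = S"
  unfolding inverse_op_def using is_inverse_op_unique by blast

lemma is_inverse_op_inverse_op: "invertible_op T \<Longrightarrow> is_inverse_op T (inverse_op T)"
  by (metis invertible_op_def inverse_op_eq)

lemma clinear_op_inverse:
  assumes "is_inverse_op T S" "clinear_op T"
  shows "clinear_op S"
  using assms unfolding clinear_op_def is_inverse_op_iff by metis

lemma is_inverse_op_minus:
  assumes "is_inverse_op T S"
  shows "is_inverse_op (- T) (- S)"
  using assms unfolding is_inverse_op_iff blinfun.minus_left blinfun.minus_right minus_minus .

lemma is_inverse_op_left_right:
  assumes "\<And>v. blinfun_apply T (blinfun_apply S v) = v"
    and "\<And>v. blinfun_apply S' (blinfun_apply T v) = v"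
  shows "is_inverse_op T S"
  using assms unfolding is_inverse_op_iff by metis

lemma is_inverse_op_comp:
  assumes "is_inverse_op T T'" "is_inverse_op S S'"
  shows "is_inverse_op (T o\<^sub>L S) (S' o\<^sub>L T')"
  using assms by (simp add: is_inverse_op_iff)

lemma invertible_op_comp_right_iff:
  assumes "is_inverse_op S S'"
  shows "invertible_op (T o\<^sub>L S) \<longleftrightarrow> invertible_op T"
proof
  assume "invertible_op (T o\<^sub>L S)"
  then obtain R where "is_inverse_op (T o\<^sub>L S) R" unfolding invertible_op_def ..
  moreover have "is_inverse_op S' S" using assms by (simp add: is_inverse_op_def)
  ultimately have "is_inverse_op ((T o\<^sub>L S) o\<^sub>L S') (S o\<^sub>L R)" by (rule is_inverse_op_comp)
  moreover have "(T o\<^sub>L S) o\<^sub>L S' = T"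
    using assms by (intro blinfun_eqI) (simp add: is_inverse_op_iff)
  ultimately show "invertible_op T" unfolding invertible_op_def by auto
next
  assume "invertible_op T"
  then show "invertible_op (T o\<^sub>L S)"
    using is_inverse_op_comp assms unfolding invertible_op_def by blast
qed

text \<open>
  Invertibility is stable under small perturbations: \<open>K x + E x = y\<close> is a fixed-point
  equation for the contraction \<open>x \<mapsto> K' (y - E x)\<close>.
\<close>

lemma is_inverse_op_perturbation:
  fixes K E :: "'a::banach \<Rightarrow>\<^sub>L 'a"
  assumes K: "is_inverse_op K K'" and small: "norm K' * norm E < 1"
  obtains N where "is_inverse_op (K + E) N" "norm N \<le> norm K' / (1 - norm K' * norm E)"
proof -
  have KK: "blinfun_apply K (blinfun_apply K' v) = v" "blinfun_apply K' (blinfun_apply K v) = v" for v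
    using K by (auto simp: is_inverse_op_iff)
  have "\<exists>!x. blinfun_apply (K + E) x = y" for y
  proof -
    define f where "f x = blinfun_apply K' (y - blinfun_apply E x)" for x
    have "dist (f x) (f x') \<le> (norm K' * norm E) * dist x x'" for x x'
    proof -
      have "f x - f x' = - blinfun_apply K' (blinfun_apply E (x - x'))"
        by (simp add: f_def blinfun.bilinear_simps)
      then have "dist (f x) (f x') \<le> norm K' * norm (blinfun_apply E (x - x'))"
        using norm_blinfun[of K' "blinfun_apply E (x - x')"] by (simp add: dist_norm)
      also have "\<dots> \<le> norm K' * (norm E * norm (x - x'))"
        by (intro mult_left_mono norm_blinfun) auto
      finally show ?thesis by (simp add: dist_norm mult.assoc)
    qed
    then have "\<exists>!x. f x = x"
      using small by (intro banach_fix_type[of "norm K' * norm E"]) auto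
    moreover have "f x = x \<longleftrightarrow> blinfun_apply (K + E) x = y" for x
      unfolding f_def blinfun.add_left by (metis KK add.commute diff_add_cancel eq_diff_eq)
    ultimately show ?thesis by simp
  qed
  then obtain g where g: "\<And>y x. blinfun_apply (K + E) x = y \<longleftrightarrow> x = g y" by metis
  have bound: "norm (g y) \<le> norm y * (norm K' / (1 - norm K' * norm E))" for y
  proof -
    have "blinfun_apply (K + E) (g y) = y" using g by blast
    then have "blinfun_apply K (g y) = y - blinfun_apply E (g y)"
      by (simp add: blinfun.add_left eq_diff_eq)
    then have "g y = blinfun_apply K' (y - blinfun_apply E (g y))" by (metis KK(2))
    then have "norm (g y) \<le> norm K' * norm (y - blinfun_apply E (g y))"
      by (metis norm_blinfun)
    also have "\<dots> \<le> norm K' * (norm y + norm E * norm (g y))"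
      by (intro mult_left_mono norm_triangle_le_diff add_left_mono norm_blinfun) auto
    finally have "norm (g y) * (1 - norm K' * norm E) \<le> norm K' * norm y"
      by (simp add: algebra_simps)
    then show ?thesis using small by (simp add: field_simps)
  qed
  have bl: "bounded_linear g"
  proof (rule bounded_linear_intro)
    show "g (x + y) = g x + g y" for x y
      using g by (metis blinfun.add_right)
    show "g (r *\<^sub>R x) = r *\<^sub>R g x" for r x
      using g by (metis blinfun.scaleR_right)
  qed (rule bound)
  show thesis
  proof
    show "is_inverse_op (K + E) (Blinfun g)"
      unfolding is_inverse_op_iff bounded_linear_Blinfun_apply[OF bl] using g by metis
    show "norm (Blinfun g) \<le> norm K' / (1 - norm K' * norm E)"
      using small bound
      by (intro norm_blinfun_bound) (auto simp: bounded_linear_Blinfun_apply[OF bl] mult.commute)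
  qed
qed


section \<open>Riesz projections of rank one\<close>

text \<open>
  Continuity makes the resolvent integrable over the circle, so that the integral defining
  \<open>riesz_projection\<close> commutes with bounded linear maps.
\<close>

lemma continuous_on_resolvent:
  fixes T :: "'a::chilbert_space \<Rightarrow>\<^sub>L 'a"
  assumes inv: "\<And>w. w \<in> C \<Longrightarrow> invertible_op (scale_op w id_blinfun - T)"
  shows "continuous_on C (\<lambda>w. inverse_op (scale_op w id_blinfun - T))"
  unfolding continuous_on_def
proof
  define R where "R w = inverse_op (scale_op w id_blinfun - T)" for w
  fix w0 assume w0: "w0 \<in> C"
  have R0: "is_inverse_op (scale_op w0 id_blinfun - T) (R w0)"
    unfolding R_def by (intro is_inverse_op_inverse_op inv w0)
  have "((\<lambda>w. R w - R w0) \<longlongrightarrow> 0) (at w0 within C)"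
  proof (rule Lim_null_comparison)
    have "((\<lambda>w. norm (R w0) * cmod (w - w0)) \<longlongrightarrow> 0) (at w0 within C)"
      by (auto intro!: tendsto_eq_intros)
    then have ev: "\<forall>\<^sub>F w in at w0 within C. norm (R w0) * cmod (w - w0) < 1 / 2"
      by (rule order_tendstoD) simp
    show "\<forall>\<^sub>F w in at w0 within C. norm (R w - R w0) \<le> 2 * (norm (R w0))\<^sup>2 * cmod (w - w0)"
      using ev
    proof eventually_elim
      case (elim w)
      let ?E = "scale_op (w - w0) (id_blinfun :: 'a \<Rightarrow>\<^sub>L 'a)"
      have "norm ?E \<le> cmod (w - w0) * norm (id_blinfun :: 'a \<Rightarrow>\<^sub>L 'a)"
        by (rule norm_scale_op_le)
      also have "\<dots> \<le> cmod (w - w0) * 1"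
        by (intro mult_left_mono norm_blinfun_bound) auto
      finally have E: "norm ?E \<le> cmod (w - w0)" by simp
      then have "norm (R w0) * norm ?E \<le> norm (R w0) * cmod (w - w0)"
        by (rule mult_left_mono) simp
      then have E12: "norm (R w0) * norm ?E \<le> 1 / 2" using elim by linarith
      obtain N where N: "is_inverse_op (scale_op w0 id_blinfun - T + ?E) N"
        "norm N \<le> norm (R w0) / (1 - norm (R w0) * norm ?E)"
        using is_inverse_op_perturbation[OF R0, of ?E] E12 by auto
      have "scale_op w0 id_blinfun - T + ?E = scale_op w id_blinfun - T"
        by (intro blinfun_eqI) (simp add: blinfun.add_left blinfun.diff_left scaleC_minus_left)
      then have Rw: "is_inverse_op (scale_op w id_blinfun - T) N" using N(1) by (simp only:)
      then have RN: "R w = N" unfolding R_def by (rule inverse_op_eq)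
      have "norm (R w0) / (1 - norm (R w0) * norm ?E) \<le> norm (R w0) / (1 / 2)"
        using E12 by (intro divide_left_mono) auto
      with N(2) have "norm N \<le> norm (R w0) / (1 / 2)" by (rule order_trans)
      then have normN: "norm N \<le> 2 * norm (R w0)" by simp
      have "R w - R w0 = - (N o\<^sub>L (?E o\<^sub>L R w0))"
      proof (rule blinfun_eqI)
        fix v
        let ?u = "blinfun_apply (R w0) v"
        have "v = w0 *\<^sub>C ?u - blinfun_apply T ?u"
          using R0 by (simp add: is_inverse_op_iff blinfun.diff_left)
        moreover have "blinfun_apply N (w *\<^sub>C ?u - blinfun_apply T ?u) = ?u"
          using Rw by (simp add: is_inverse_op_iff blinfun.diff_left)
        ultimately have "blinfun_apply N v - ?u
            = blinfun_apply N ((w0 *\<^sub>C ?u - blinfun_apply T ?u) - (w *\<^sub>C ?u - blinfun_apply T ?u))"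
          by (metis blinfun.diff_right)
        also have "(w0 *\<^sub>C ?u - blinfun_apply T ?u) - (w *\<^sub>C ?u - blinfun_apply T ?u)
            = - ((w - w0) *\<^sub>C ?u)"
          by (simp add: scaleC_minus_left)
        finally show "blinfun_apply (R w - R w0) v = blinfun_apply (- (N o\<^sub>L (?E o\<^sub>L R w0))) v"
          by (simp add: RN blinfun.bilinear_simps)
      qed
      then have "norm (R w - R w0) \<le> norm N * (norm ?E * norm (R w0))"
        using norm_blinfun_compose[of N "?E o\<^sub>L R w0"]
          mult_left_mono[OF norm_blinfun_compose[of ?E "R w0"], of "norm N"] by simp
      also have "\<dots> \<le> (2 * norm (R w0)) * (cmod (w - w0) * norm (R w0))"
        by (intro mult_mono normN mult_right_mono E) auto
      finally show ?case by (simp add: power2_eq_square mult_ac)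
    qed
    show "((\<lambda>w. 2 * (norm (R w0))\<^sup>2 * cmod (w - w0)) \<longlongrightarrow> 0) (at w0 within C)"
      by (auto intro!: tendsto_eq_intros)
  qed
  then show "(R \<longlongrightarrow> R w0) (at w0 within C)" by (rule LIM_zero_cancel)
qed

text \<open>
  Integrating the identity \<open>(T - z) R(w) = (w - z) R(w) - I\<close> for the resolvent \<open>R\<close> against
  \<open>dw / (2 \<pi> i (w - z))\<close> over the circle gives a Riesz projection on the right and, on the left,
  the operator \<open>S\<close>, the constant Laurent coefficient of \<open>R\<close>. With \<open>w = z + \<rho> exp (2 \<pi> i t)\<close> the
  measure \<open>dw / (2 \<pi> i (w - z))\<close> becomes \<open>dt\<close>.
\<close>

lemma riesz_projection_reduced_resolvent:
  fixes T :: "'a::chilbert_space \<Rightarrow>\<^sub>L 'a"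
  assumes T: "clinear_op T" and \<rho>: "\<rho> > 0"
    and inv: "\<And>w. cmod (w - z) = \<rho> \<Longrightarrow> invertible_op (scale_op w id_blinfun - T)"
  defines "Q \<equiv> riesz_projection T z \<rho>"
  obtains S where
    "\<And>v. blinfun_apply (T - scale_op z id_blinfun) (blinfun_apply S v) = blinfun_apply Q v - v"
    "\<And>v. blinfun_apply S (blinfun_apply (T - scale_op z id_blinfun) v) = blinfun_apply Q v - v"
proof -
  define \<gamma> where "\<gamma> = circlepath z \<rho>"
  define R where "R t = inverse_op (scale_op (\<gamma> t) id_blinfun - T)" for t
  define X where "X = T - scale_op z id_blinfun"
  have \<gamma>: "cmod (\<gamma> t - z) = \<rho>" for t
    using \<rho> by (simp add: \<gamma>_def circlepath norm_mult)
  have R: "is_inverse_op (scale_op (\<gamma> t) id_blinfun - T) (R t)" for t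
    unfolding R_def by (intro is_inverse_op_inverse_op inv \<gamma>)
  have cont\<gamma>: "continuous_on {0..1} \<gamma>"
    using path_circlepath[of z \<rho>] by (simp add: path_def \<gamma>_def)
  have contRes: "continuous_on {w. cmod (w - z) = \<rho>} (\<lambda>w. inverse_op (scale_op w id_blinfun - T))"
    by (intro continuous_on_resolvent inv) auto
  have contR: "continuous_on {0..1} R"
    unfolding R_def by (rule continuous_on_compose2[OF contRes cont\<gamma>]) (auto simp: \<gamma>)
  have cont\<gamma>R: "continuous_on {0..1} (\<lambda>t. scale_op (\<gamma> t - z) (R t))"
    by (intro bounded_bilinear.continuous_on[OF bounded_bilinear_scale_op] continuous_intros
        cont\<gamma> contR)
  have apply_integral: "blinfun_apply (integral {0..1} F) v = integral {0..1} (\<lambda>t. blinfun_apply (F t) v)"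
    "(\<lambda>t. blinfun_apply (F t) v) integrable_on {0..1}"
    if "continuous_on {0..1} F" for F :: "real \<Rightarrow> 'a \<Rightarrow>\<^sub>L 'a" and v
    using integral_linear[OF integrable_continuous_interval[OF that] blinfun.bounded_linear_left[of v]]
      integrable_linear[OF integrable_continuous_interval[OF that] blinfun.bounded_linear_left[of v]]
    by (simp_all add: o_def)
  have vd: "vector_derivative \<gamma> (at t within {0..1}) = (2 * of_real pi * \<i>) * (\<gamma> t - z)"
    if "t \<in> {0..1}" for t
    using that by (simp add: \<gamma>_def vector_derivative_circlepath01) (simp add: circlepath)
  have "contour_integral_op \<gamma> (\<lambda>w. inverse_op (scale_op w id_blinfun - T))
      = integral {0..1} (\<lambda>t. scale_op (2 * of_real pi * \<i>) (scale_op (\<gamma> t - z) (R t)))"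
    unfolding contour_integral_op_def R_def
    by (intro integral_cong blinfun_eqI) (simp add: vd scaleC_scaleC)
  also have "\<dots> = scale_op (2 * of_real pi * \<i>) (integral {0..1} (\<lambda>t. scale_op (\<gamma> t - z) (R t)))"
    using integral_linear[OF integrable_continuous_interval[OF cont\<gamma>R]
        bounded_bilinear.bounded_linear_right[OF bounded_bilinear_scale_op, of "2 * of_real pi * \<i>"]]
    by (simp add: o_def)
  finally have Q: "Q = integral {0..1} (\<lambda>t. scale_op (\<gamma> t - z) (R t))"
    unfolding Q_def riesz_projection_def \<gamma>_def
    by (intro blinfun_eqI) (simp add: scaleC_scaleC)
  have Qv: "blinfun_apply Q v - v = integral {0..1} (\<lambda>t. (\<gamma> t - z) *\<^sub>C blinfun_apply (R t) v - v)" for v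
    unfolding Q using apply_integral[OF cont\<gamma>R, of v]
    by (subst integral_diff) auto
  have RX: "blinfun_apply X (blinfun_apply (R t) v) = (\<gamma> t - z) *\<^sub>C blinfun_apply (R t) v - v" for t v
  proof -
    have "\<gamma> t *\<^sub>C blinfun_apply (R t) v - blinfun_apply T (blinfun_apply (R t) v) = v"
      using R[of t] by (simp add: is_inverse_op_iff blinfun.diff_left)
    then show ?thesis by (simp add: X_def blinfun.diff_left scaleC_minus_left algebra_simps)
  qed
  have XR: "blinfun_apply (R t) (blinfun_apply X v) = (\<gamma> t - z) *\<^sub>C blinfun_apply (R t) v - v" for t v
  proof -
    have cl: "clinear_op (R t)" using clinear_op_inverse[OF R clinear_op_shift[OF T]] .
    have "blinfun_apply (R t) (\<gamma> t *\<^sub>C v - blinfun_apply T v) = v"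
      using R[of t] by (simp add: is_inverse_op_iff blinfun.diff_left)
    then have "\<gamma> t *\<^sub>C blinfun_apply (R t) v - blinfun_apply (R t) (blinfun_apply T v) = v"
      by (simp add: blinfun.diff_right clinear_op_scaleC[OF cl])
    then show ?thesis
      by (simp add: X_def blinfun.bilinear_simps scaleC_minus_left clinear_op_scaleC[OF cl] algebra_simps)
  qed
  show thesis
  proof
    fix v
    have "blinfun_apply X (blinfun_apply (integral {0..1} R) v)
        = integral {0..1} (\<lambda>t. blinfun_apply X (blinfun_apply (R t) v))"
      using integral_linear[OF apply_integral(2)[OF contR] blinfun.bounded_linear_right, of X v]
      by (simp add: o_def apply_integral(1)[OF contR])
    then show "blinfun_apply (T - scale_op z id_blinfun) (blinfun_apply (integral {0..1} R) v)
        = blinfun_apply Q v - v"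
      unfolding X_def[symmetric] Qv by (simp add: RX)
    show "blinfun_apply (integral {0..1} R) (blinfun_apply (T - scale_op z id_blinfun) v)
        = blinfun_apply Q v - v"
      unfolding X_def[symmetric] Qv by (simp add: apply_integral(1)[OF contR] XR)
  qed
qed

lemma rank_one_range:
  assumes "rank_one Q"
  obtains u where "blinfun_apply Q u \<noteq> 0" "\<And>v. \<exists>c. blinfun_apply Q v = c *\<^sub>C blinfun_apply Q u"
proof -
  let ?V = "range (blinfun_apply Q)"
  obtain b where b: "b \<subseteq> ?V" "complex_vector.independent b" "?V \<subseteq> complex_vector.span b"
    "card b = complex_vector.dim ?V"
    using complex_vector.basis_exists[of ?V] by blast
  then obtain p where p: "b = {p}"
    using assms unfolding rank_one_def by (metis card_1_singletonE)
  then obtain u where "p = blinfun_apply Q u" using b by auto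
  moreover have "p \<noteq> 0" using b p complex_vector.dependent_zero by blast
  moreover have "\<exists>c. blinfun_apply Q v = c *\<^sub>C p" for v
  proof -
    have "blinfun_apply Q v \<in> complex_vector.span {p}" using b p by blast
    then show ?thesis by (auto simp: complex_vector.span_singleton)
  qed
  ultimately show thesis using that by blast
qed

text \<open>
  The operator \<open>K\<close> below equals \<open>T - I\<close> on the complement of \<open>p\<close> and sends \<open>p\<close> to itself, so its
  invertibility says that \<open>1\<close> is a simple isolated eigenvalue of \<open>T\<close>, with \<open>p\<close> spanning a
  reducing eigenspace. First order perturbation theory needs exactly this much.
\<close>

definition simple_fixed_vector :: "('a::complex_inner \<Rightarrow>\<^sub>L 'a) \<Rightarrow> 'a \<Rightarrow> bool" where
  "simple_fixed_vector T p \<longleftrightarrow>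
     norm p = 1 \<and> blinfun_apply T p = p \<and>
     (\<forall>v. cinner (blinfun_apply T v) p = cinner v p) \<and>
     (\<exists>K. invertible_op K \<and> (\<forall>v. blinfun_apply K v = blinfun_apply T v - v + cinner v p *\<^sub>C p))"

lemma simple_fixed_vector_unique:
  assumes T: "clinear_op T" and "simple_fixed_vector T p" "blinfun_apply T v = v"
  shows "v = cinner v p *\<^sub>C p"
proof -
  obtain K K' where K: "is_inverse_op K K'"
      "\<And>v. blinfun_apply K v = blinfun_apply T v - v + cinner v p *\<^sub>C p"
    using assms(2) by (auto simp: simple_fixed_vector_def invertible_op_def)
  have "norm p = 1" "blinfun_apply T p = p"
    using assms(2) by (auto simp: simple_fixed_vector_def)
  then have "blinfun_apply K (cinner v p *\<^sub>C p) = blinfun_apply K v"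
    using assms(3) by (simp add: K(2) clinear_op_scaleC[OF T] cinner_scaleC_left cinner_self)
  then show ?thesis using K(1) by (metis is_inverse_op_iff)
qed

text \<open>
  Since \<open>Q\<close> has rank one and commutes with \<open>X = T - I\<close>, the vector \<open>p\<close> spanning its range is an
  eigenvector of \<open>X\<close>. A nonzero eigenvalue \<open>\<mu>\<close> would make \<open>Q / \<mu> - S\<close> an inverse of \<open>X\<close>; so
  \<open>X p = 0\<close>, and \<open>Q - S + Q S\<close> and \<open>Q - S + S Q\<close> invert \<open>X + Q\<close> from the two sides.
\<close>

lemma multiplicity_one_simple_fixed_vector:
  fixes As :: "('a::chilbert_space \<Rightarrow>\<^sub>L 'a) list"
  assumes mult: "multiplicity_one As x" and T: "clinear_op (pencil As x)"
    and adj: "\<And>p v. blinfun_apply (pencil As x) p = p \<Longrightarrow> cinner (blinfun_apply (pencil As x) v) p = cinner v p"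
  obtains p where "simple_fixed_vector (pencil As x) p"
proof -
  define T where "T = pencil As x"
  have clT: "clinear_op T" using assms(2) by (simp add: T_def)
  have iso: "1 isolated_in spectrum_op T" and ev: "\<forall>\<^sub>F \<rho> in at_right 0. rank_one (riesz_projection T 1 \<rho>)"
    using mult by (auto simp: multiplicity_one_def T_def)
  obtain d where d: "d > 0" "\<And>w. w \<in> spectrum_op T \<Longrightarrow> dist 1 w < d \<Longrightarrow> w = 1"
    using iso unfolding isolated_in_dist_Ex_iff by blast
  have "\<forall>\<^sub>F \<rho> in at_right 0. \<rho> < d"
    by (rule order_tendstoD(2)[OF tendsto_ident_at d(1)])
  moreover have "\<forall>\<^sub>F \<rho> in at_right 0. (0::real) < \<rho>" by (rule eventually_at_right_less)
  ultimately have "\<forall>\<^sub>F \<rho> in at_right 0. rank_one (riesz_projection T 1 \<rho>) \<and> \<rho> < d \<and> 0 < \<rho>"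
    using ev by eventually_elim simp
  then obtain \<rho> where \<rho>: "rank_one (riesz_projection T 1 \<rho>)" "\<rho> < d" "0 < \<rho>"
    using eventually_happens'[OF trivial_limit_at_right_real] by blast
  define Q where "Q = riesz_projection T 1 \<rho>"
  define X where "X = T - scale_op 1 id_blinfun"
  have Xv: "blinfun_apply X v = blinfun_apply T v - v" for v by (simp add: X_def blinfun.diff_left)
  have Xc: "blinfun_apply X (c *\<^sub>C v) = c *\<^sub>C blinfun_apply X v" for c v
    by (simp add: Xv clinear_op_scaleC[OF clT] complex_vector.scale_right_diff_distrib)
  have "invertible_op (scale_op w id_blinfun - T)" if "cmod (w - 1) = \<rho>" for w
  proof -
    have "dist 1 w < d" "w \<noteq> 1" using that \<rho> by (auto simp: dist_norm norm_minus_commute)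
    then have "w \<notin> spectrum_op T" using d(2) by blast
    then show ?thesis by (simp add: spectrum_op_def)
  qed
  then obtain S where
    XS: "\<And>v. blinfun_apply X (blinfun_apply S v) = blinfun_apply Q v - v" and
    SX: "\<And>v. blinfun_apply S (blinfun_apply X v) = blinfun_apply Q v - v"
    using riesz_projection_reduced_resolvent[OF clT \<rho>(3), of 1] unfolding Q_def X_def by blast
  have comm: "blinfun_apply Q (blinfun_apply X v) = blinfun_apply X (blinfun_apply Q v)" for v
    using XS[of "blinfun_apply X v"] arg_cong[OF SX[of v], of "blinfun_apply X"]
    by (simp add: blinfun.diff_right)
  obtain u where u: "blinfun_apply Q u \<noteq> 0" "\<And>v. \<exists>c. blinfun_apply Q v = c *\<^sub>C blinfun_apply Q u"
    using rank_one_range[OF \<rho>(1)] unfolding Q_def by blast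
  obtain \<mu> where \<mu>: "blinfun_apply X (blinfun_apply Q u) = \<mu> *\<^sub>C blinfun_apply Q u"
    using u(2) comm by metis
  have XQ: "blinfun_apply X (blinfun_apply Q v) = \<mu> *\<^sub>C blinfun_apply Q v" for v
  proof -
    obtain c where "blinfun_apply Q v = c *\<^sub>C blinfun_apply Q u" using u(2) by blast
    then show ?thesis by (simp add: Xc \<mu> scaleC_scaleC mult.commute)
  qed
  have "\<mu> = 0"
  proof (rule ccontr)
    assume \<mu>: "\<mu> \<noteq> 0"
    have "is_inverse_op X (scale_op (1 / \<mu>) Q - S)"
      unfolding is_inverse_op_iff using \<mu>
      by (simp add: blinfun.bilinear_simps Xc XS SX XQ comm scaleC_scaleC)
    then have "is_inverse_op (- X) (- (scale_op (1 / \<mu>) Q - S))"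
      by (rule is_inverse_op_minus)
    then have "invertible_op (scale_op 1 id_blinfun - T)"
      unfolding invertible_op_def X_def by (metis minus_diff_eq)
    moreover have "1 \<in> spectrum_op T" using iso by (simp add: isolated_in_def)
    ultimately show False by (simp add: spectrum_op_def)
  qed
  then have XQ0: "blinfun_apply X (blinfun_apply Q v) = 0" for v using XQ by simp
  have QQ: "blinfun_apply Q (blinfun_apply Q v) = blinfun_apply Q v" for v
    using SX[of "blinfun_apply Q v"] by (simp add: XQ0)
  define p where "p = (1 / norm (blinfun_apply Q u)) *\<^sub>R blinfun_apply Q u"
  have p: "norm p = 1" "blinfun_apply T p = p"
    using u(1) XQ0[of u] by (simp_all add: p_def Xv blinfun.scaleR_right)
  have adjT: "cinner (blinfun_apply T v) p = cinner v p" for v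
    using adj p(2) by (simp add: T_def)
  have Q: "blinfun_apply Q v = cinner v p *\<^sub>C p" for v
  proof -
    have "cinner (blinfun_apply Q v - v) p = 0"
      unfolding XS[symmetric] Xv by (simp add: cinner_diff_left adjT)
    then have *: "cinner (blinfun_apply Q v) p = cinner v p" by (simp add: cinner_diff_left)
    obtain c where "blinfun_apply Q v = c *\<^sub>C blinfun_apply Q u" using u(2) by blast
    also have "blinfun_apply Q u = of_real (norm (blinfun_apply Q u)) *\<^sub>C p"
      using u(1) by (simp add: p_def scaleC_of_real)
    finally have c: "blinfun_apply Q v = (c * of_real (norm (blinfun_apply Q u))) *\<^sub>C p"
      by (simp add: scaleC_scaleC)
    then show ?thesis using * p(1) by (simp add: cinner_scaleC_left cinner_self)
  qed
  have "is_inverse_op (X + Q) (Q - S + (Q o\<^sub>L S))"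
    by (rule is_inverse_op_left_right[where S' = "Q - S + (S o\<^sub>L Q)"])
       (simp_all add: blinfun.bilinear_simps XS SX XQ0 QQ comm)
  then have "invertible_op (X + Q)" unfolding invertible_op_def by blast
  moreover have "blinfun_apply (X + Q) v = blinfun_apply T v - v + cinner v p *\<^sub>C p" for v
    by (simp add: blinfun.add_left Xv Q)
  ultimately have "simple_fixed_vector T p"
    unfolding simple_fixed_vector_def using p adjT by blast
  then show thesis using that by (simp add: T_def)
qed


section \<open>Normal operators and contractions\<close>

text \<open>
  An eigenvector \<open>p\<close> of a normal operator is an eigenvector of the adjoint \<open>S\<close> for the conjugate
  eigenvalue: the defect \<open>q = S p - cnj c p\<close> is again an eigenvector of \<open>A\<close> because \<open>A\<close> and \<open>S\<close>
  commute, and this makes \<open>q\<close> orthogonal to itself.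
\<close>

lemma normal_op_eigenvector:
  assumes "normal_op A" "clinear_op A" "blinfun_apply A p = c *\<^sub>C p"
  shows "cinner (blinfun_apply A v) p = c * cinner v p"
proof -
  obtain S where S: "\<And>x y. cinner (blinfun_apply A x) y = cinner x (blinfun_apply S y)"
    and comm: "\<And>x. blinfun_apply A (blinfun_apply S x) = blinfun_apply S (blinfun_apply A x)"
    using assms(1) unfolding normal_op_def is_adjoint_def by (metis blinfun_apply_blinfun_compose)
  have S': "cinner (blinfun_apply S x) y = cinner x (blinfun_apply A y)" for x y
    by (metis S cinner_commute)
  have Sc: "blinfun_apply S (c *\<^sub>C p) = c *\<^sub>C blinfun_apply S p"
  proof -
    have "cinner (blinfun_apply S (c *\<^sub>C p) - c *\<^sub>C blinfun_apply S p) y = 0" for y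
      by (simp add: cinner_diff_left S' cinner_scaleC_left)
    from this[of "blinfun_apply S (c *\<^sub>C p) - c *\<^sub>C blinfun_apply S p"] show ?thesis by simp
  qed
  define q where "q = blinfun_apply S p - cnj c *\<^sub>C p"
  have ASp: "blinfun_apply A (blinfun_apply S p) = c *\<^sub>C blinfun_apply S p"
    using comm[of p] by (simp add: assms(3) Sc)
  have Aq: "blinfun_apply A q = c *\<^sub>C q"
    by (simp add: q_def blinfun.diff_right ASp clinear_op_scaleC[OF assms(2)] assms(3) scaleC_scaleC
        complex_vector.scale_right_diff_distrib mult.commute)
  have "cinner q q = cinner q (blinfun_apply S p) - cinner q (cnj c *\<^sub>C p)"
    by (subst (2) q_def) (simp add: cinner_diff_right)
  also have "\<dots> = 0" by (simp add: S[symmetric] Aq cinner_scaleC_left cinner_scaleC_right)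
  finally have "blinfun_apply S p = cnj c *\<^sub>C p" by (simp add: q_def)
  then show ?thesis by (simp add: S cinner_scaleC_right)
qed

text \<open>
  A contraction that preserves the norm of \<open>w\<close> satisfies \<open>B\<^sup>* B w = w\<close>: the difference
  \<open>\<parallel>w + x\<parallel>\<^sup>2 - \<parallel>B (w + x)\<parallel>\<^sup>2\<close> is nonnegative and vanishes at \<open>x = 0\<close>, so its first order term
  \<open>2 Re (\<langle>x, w\<rangle> - \<langle>B x, B w\<rangle>)\<close> is zero for all \<open>x\<close>.
\<close>

lemma contraction_cinner_preserved:
  assumes B: "clinear_op B" "norm B \<le> 1" and w: "norm (blinfun_apply B w) = norm w"
  shows "cinner (blinfun_apply B v) (blinfun_apply B w) = cinner v w"
proof -
  have le: "norm (blinfun_apply B x) \<le> norm x" for x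
    using norm_blinfun[of B x] mult_right_mono[OF B(2), of "norm x"] by simp
  define k where "k = cinner (blinfun_apply B v) (blinfun_apply B w) - cinner v w"
  have main: "2 * e * (cmod k)\<^sup>2 \<le> e\<^sup>2 * (cmod k * norm v)\<^sup>2" for e :: real
  proof -
    \<comment> \<open>The phase of \<open>cnj k\<close> makes the first order term equal to \<open>- 2 e \<bar>k\<bar>\<^sup>2\<close>.\<close>
    define x where "x = (of_real e * cnj k) *\<^sub>C v"
    have 1: "norm (w - (- x)) ^ 2 = norm w ^ 2 + 2 * Re (cinner x w) + norm x ^ 2"
      unfolding norm_diff_squared using cinner_commute[of w x] by (simp add: cinner_minus_right)
    have 2: "norm (blinfun_apply B w - (- blinfun_apply B x)) ^ 2
        = norm w ^ 2 + 2 * Re (cinner (blinfun_apply B x) (blinfun_apply B w)) + norm (blinfun_apply B x) ^ 2"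
      unfolding norm_diff_squared using cinner_commute[of "blinfun_apply B w" "blinfun_apply B x"] w
      by (simp add: cinner_minus_right)
    have 3: "norm (blinfun_apply B w - (- blinfun_apply B x)) ^ 2 \<le> norm (w - (- x)) ^ 2"
      using le[of "w + x"] by (simp add: blinfun.add_right power_mono)
    have "cinner (blinfun_apply B x) (blinfun_apply B w) - cinner x w = of_real e * (k * cnj k)"
      by (simp add: x_def clinear_op_scaleC[OF B(1)] blinfun.scaleR_right cinner_scaleC_left mult_ac
          flip: right_diff_distrib k_def)
    also have "\<dots> = of_real (e * (cmod k)\<^sup>2)" by (simp only: complex_norm_square of_real_mult)
    finally have 4: "Re (cinner (blinfun_apply B x) (blinfun_apply B w)) - Re (cinner x w) = e * (cmod k)\<^sup>2"
      by (metis Re_complex_of_real minus_complex.simps(1))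
    have "norm x ^ 2 = e\<^sup>2 * (cmod k * norm v)\<^sup>2"
      by (simp add: x_def norm_scaleC norm_mult power_mult_distrib)
    then show ?thesis using 1 2 3 4 zero_le_power2[of "norm (blinfun_apply B x)"] by linarith
  qed
  have "k = 0"
  proof (rule ccontr)
    assume k: "k \<noteq> 0"
    \<comment> \<open>Small enough for the linear term in \<open>main\<close> to outweigh the quadratic one.\<close>
    define e where "e = 1 / (1 + (norm v)\<^sup>2)"
    have pos: "e > 0" by (simp add: e_def add_pos_nonneg)
    have "2 * e * (cmod k)\<^sup>2 \<le> (e * (norm v)\<^sup>2) * (e * (cmod k)\<^sup>2)"
      using main[of e] by (simp add: power2_eq_square mult_ac)
    then have "2 * (e * (cmod k)\<^sup>2) \<le> (e * (norm v)\<^sup>2) * (e * (cmod k)\<^sup>2)" by simp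
    moreover have "e * (norm v)\<^sup>2 \<le> 1" by (simp add: e_def divide_le_eq add_pos_nonneg)
    moreover have "0 < e * (cmod k)\<^sup>2" using pos k by simp
    ultimately show False using mult_right_mono[of "e * (norm v)\<^sup>2" 1 "e * (cmod k)\<^sup>2"] by linarith
  qed
  then show ?thesis by (simp add: k_def)
qed


section \<open>First order perturbation of a simple eigenvalue\<close>

text \<open>
  Let \<open>P v = \<langle>v, p\<rangle> p\<close>. With \<open>N\<close> invertible, \<open>N - P\<close> fails to be invertible only if
  \<open>\<langle>N\<^sup>-\<^sup>1 p, p\<rangle> = 1\<close>: otherwise the Sherman--Morrison formula gives the inverse.
\<close>

lemma rank_one_update_noninvertible:
  fixes M :: "'a::complex_inner \<Rightarrow>\<^sub>L 'a"
  assumes N: "is_inverse_op N N'" "clinear_op N"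
    and M: "\<And>v. blinfun_apply M v = blinfun_apply N v - cinner v p *\<^sub>C p"
    and sing: "\<not> invertible_op M"
  shows "cinner (blinfun_apply N' p) p = 1"
proof (rule ccontr)
  define s where "s = cinner (blinfun_apply N' p) p"
  assume "cinner (blinfun_apply N' p) p \<noteq> 1"
  then have s: "1 - s \<noteq> 0" by (simp add: s_def)
  define d where "d = 1 / (1 - s)"
  have d: "d - d * s = 1" using s by (simp add: d_def field_simps)
  have N'c: "clinear_op N'" using clinear_op_inverse[OF N] .
  have NN: "blinfun_apply N (blinfun_apply N' v) = v" "blinfun_apply N' (blinfun_apply N v) = v" for v
    using N(1) by (auto simp: is_inverse_op_iff)
  define g where "g v = blinfun_apply N' v + (d * cinner (blinfun_apply N' v) p) *\<^sub>C blinfun_apply N' p" for v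
  have "bounded_linear g"
    unfolding g_def
    by (intro bounded_linear_add blinfun.bounded_linear_right
        bounded_linear_compose[OF bounded_bilinear.bounded_linear_left[OF bounded_bilinear_scaleC]]
        bounded_linear_const_mult
        bounded_linear_compose[OF bounded_bilinear.bounded_linear_left[OF bounded_bilinear_cinner]])
  then have g: "blinfun_apply (Blinfun g) = g" by (rule bounded_linear_Blinfun_apply)
  have "is_inverse_op M (Blinfun g)"
    unfolding is_inverse_op_iff g
  proof (intro conjI allI)
    fix v
    let ?m = "cinner (blinfun_apply N' v) p"
    have "blinfun_apply M (g v) = v + (d * ?m - (?m + d * ?m * s)) *\<^sub>C p"
      by (simp add: M g_def blinfun.add_right NN clinear_op_scaleC[OF N(2)] cinner_add_left
          cinner_scaleC_left scaleC_minus_left scaleC_add_left flip: s_def)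
    also have "d * ?m - (?m + d * ?m * s) = ?m * (d - d * s - 1)" by (simp add: algebra_simps)
    finally show "blinfun_apply M (g v) = v" by (simp add: d)
    let ?k = "cinner v p"
    have "g (blinfun_apply M v) = v + (d * (?k - ?k * s) - ?k) *\<^sub>C blinfun_apply N' p"
      by (simp add: M g_def blinfun.diff_right NN clinear_op_scaleC[OF N'c] cinner_diff_left
          cinner_scaleC_left scaleC_minus_left flip: s_def)
    also have "d * (?k - ?k * s) - ?k = ?k * (d - d * s - 1)" by (simp add: algebra_simps)
    finally show "g (blinfun_apply M v) = v" by (simp add: d)
  qed
  then show False using sing unfolding invertible_op_def by blast
qed

text \<open>
  With \<open>N = T - I + P + E\<close> the previous lemma says \<open>\<langle>u, p\<rangle> = 0\<close> for \<open>u = N\<^sup>-\<^sup>1 E p\<close>, because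
  \<open>N p = p + E p\<close>. Pairing \<open>N u = E p\<close> with \<open>p\<close> leaves \<open>\<langle>E p, p\<rangle> = \<langle>E u, p\<rangle>\<close>, and the right side
  is of second order in \<open>E\<close>.
\<close>

lemma simple_fixed_vector_first_order:
  fixes T :: "'a::chilbert_space \<Rightarrow>\<^sub>L 'a" and E :: "real \<Rightarrow> 'a \<Rightarrow>\<^sub>L 'a"
  assumes p: "simple_fixed_vector T p" and T: "clinear_op T" and E: "\<And>t. clinear_op (E t)"
    and sing: "\<forall>\<^sub>F t in at_right 0. \<not> invertible_op (T - id_blinfun + E t)"
    and lim: "((\<lambda>t. E t /\<^sub>R t) \<longlongrightarrow> W) (at_right 0)"
  shows "cinner (blinfun_apply W p) p = 0"
proof -
  obtain K K' where K: "is_inverse_op K K'"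
      "\<And>v. blinfun_apply K v = blinfun_apply T v - v + cinner v p *\<^sub>C p"
    using p by (auto simp: simple_fixed_vector_def invertible_op_def)
  have pp: "norm p = 1" "blinfun_apply T p = p" "\<And>v. cinner (blinfun_apply T v) p = cinner v p"
    using p by (auto simp: simple_fixed_vector_def)
  have pp1: "cinner p p = 1" using pp(1) by (simp add: cinner_self)
  have Kcl: "clinear_op K"
    by (simp add: clinear_op_def K(2) clinear_op_scaleC[OF T] cinner_scaleC_left
        complex_vector.scale_right_diff_distrib scaleC_add_right scaleC_scaleC)
  have t0: "\<forall>\<^sub>F t in at_right (0::real). 0 < t" by (rule eventually_at_right_less)
  have id0: "((\<lambda>t::real. t) \<longlongrightarrow> 0) (at_right 0)" by (rule tendsto_ident_at)
  have "((\<lambda>t. t *\<^sub>R (E t /\<^sub>R t)) \<longlongrightarrow> 0 *\<^sub>R W) (at_right 0)" by (intro tendsto_scaleR lim id0)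
  moreover have "\<forall>\<^sub>F t in at_right 0. t *\<^sub>R (E t /\<^sub>R t) = E t"
    using t0 by eventually_elim simp
  ultimately have E0: "(E \<longlongrightarrow> 0) (at_right 0)"
    using Lim_transform_eventually by fastforce
  have "((\<lambda>t. norm K' * norm (E t)) \<longlongrightarrow> norm K' * norm (0 :: 'a \<Rightarrow>\<^sub>L 'a)) (at_right 0)"
    by (intro tendsto_intros E0)
  then have small: "\<forall>\<^sub>F t in at_right 0. norm K' * norm (E t) < 1 / 2"
    by (rule order_tendstoD) simp
  have bound: "\<forall>\<^sub>F t in at_right 0. cmod (cinner (blinfun_apply (E t /\<^sub>R t) p) p)
      \<le> norm (E t) * (2 * norm K' * norm (E t /\<^sub>R t))"
    using small sing t0
  proof eventually_elim
    case (elim t)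
    obtain N' where N': "is_inverse_op (K + E t) N'" "norm N' \<le> norm K' / (1 - norm K' * norm (E t))"
      using is_inverse_op_perturbation[OF K(1), of "E t"] elim by auto
    have "norm K' / (1 - norm K' * norm (E t)) \<le> norm K' / (1 / 2)"
      using elim by (intro divide_left_mono) auto
    with N'(2) have "norm N' \<le> norm K' / (1 / 2)" by (rule order_trans)
    then have normN': "norm N' \<le> 2 * norm K'" by simp
    have NN: "blinfun_apply (K + E t) (blinfun_apply N' v) = v" "blinfun_apply N' (blinfun_apply (K + E t) v) = v" for v
      using N'(1) by (auto simp: is_inverse_op_iff)
    have "clinear_op (K + E t)"
      using Kcl E[of t] by (simp add: clinear_op_def blinfun.add_left scaleC_add_right)
    then have one: "cinner (blinfun_apply N' p) p = 1"
      using elim(2) by (intro rank_one_update_noninvertible[OF N'(1), of "T - id_blinfun + E t"])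
        (simp_all add: blinfun.add_left blinfun.diff_left K(2))
    define u where "u = blinfun_apply N' (blinfun_apply (E t) p)"
    have "blinfun_apply (K + E t) p = p + blinfun_apply (E t) p"
      by (simp add: blinfun.add_left K(2) pp(2) pp1)
    then have "p = blinfun_apply N' p + u"
      unfolding u_def by (metis NN(2) blinfun.add_right)
    then have u0: "cinner u p = 0" using one pp1 by (metis add_cancel_right_right cinner_add_left)
    have "blinfun_apply K u + blinfun_apply (E t) u = blinfun_apply (E t) p"
      unfolding u_def by (metis NN(1) blinfun.add_left)
    moreover have "cinner (blinfun_apply K u) p = 0"
      by (simp add: K(2) cinner_add_left cinner_diff_left pp(3) u0)
    ultimately have "cinner (blinfun_apply (E t) p) p = cinner (blinfun_apply (E t) u) p"
      by (metis add_0 cinner_add_left)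
    then have "cmod (cinner (blinfun_apply (E t) p) p) \<le> norm (blinfun_apply (E t) u)"
      using cauchy_schwarz[of "blinfun_apply (E t) u" p] pp(1) by simp
    also have "\<dots> \<le> norm (E t) * norm u" by (rule norm_blinfun)
    also have "norm u \<le> norm N' * norm (blinfun_apply (E t) p)" unfolding u_def by (rule norm_blinfun)
    also have "\<dots> \<le> (2 * norm K') * norm (E t)"
      using norm_blinfun[of "E t" p] pp(1) normN' by (intro mult_mono) auto
    finally have "cmod (cinner (blinfun_apply (E t) p) p) \<le> norm (E t) * ((2 * norm K') * norm (E t))"
      by (simp add: mult_left_mono)
    then have "cmod (cinner (blinfun_apply (E t) p) p) / t
        \<le> norm (E t) * ((2 * norm K') * norm (E t)) / t"
      using elim(3) by (intro divide_right_mono) auto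
    then show ?case using elim(3)
      by (simp add: blinfun.scaleR_left bounded_bilinear.scaleR_left[OF bounded_bilinear_cinner]
          divide_inverse_commute mult_ac)
  qed
  have "((\<lambda>t. norm (E t) * (2 * norm K' * norm (E t /\<^sub>R t)))
      \<longlongrightarrow> norm (0 :: 'a \<Rightarrow>\<^sub>L 'a) * (2 * norm K' * norm W)) (at_right 0)"
    by (intro tendsto_intros E0 lim)
  then have "((\<lambda>t. cinner (blinfun_apply (E t /\<^sub>R t) p) p) \<longlongrightarrow> 0) (at_right 0)"
    using bound by (intro Lim_null_comparison[OF bound]) simp
  moreover have "((\<lambda>t. cinner (blinfun_apply (E t /\<^sub>R t) p) p) \<longlongrightarrow> cinner (blinfun_apply W p) p) (at_right 0)"
    by (intro tendsto_cinner blinfun.tendsto lim tendsto_const)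
  ultimately show ?thesis
    using tendsto_unique[OF trivial_limit_at_right_real] by blast
qed


section \<open>The surface near the eigenvalues of the normal operator\<close>

lemma neumann_inverse:
  fixes B :: "'a::banach \<Rightarrow>\<^sub>L 'a"
  assumes "0 \<le> s" "s * norm B \<le> 1 / 2"
  obtains G where "is_inverse_op (id_blinfun - s *\<^sub>R B) G" "norm G \<le> 2"
proof -
  have id: "is_inverse_op id_blinfun (id_blinfun :: 'a \<Rightarrow>\<^sub>L 'a)" by (simp add: is_inverse_op_iff)
  have le1: "norm (id_blinfun :: 'a \<Rightarrow>\<^sub>L 'a) \<le> 1" by (rule norm_blinfun_bound) auto
  have "norm (id_blinfun :: 'a \<Rightarrow>\<^sub>L 'a) * norm (- (s *\<^sub>R B)) \<le> 1 * (1 / 2)"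
    using assms by (intro mult_mono le1) auto
  then have small: "norm (id_blinfun :: 'a \<Rightarrow>\<^sub>L 'a) * norm (- (s *\<^sub>R B)) \<le> 1 / 2" by simp
  obtain G where G: "is_inverse_op (id_blinfun + - (s *\<^sub>R B)) G"
    "norm G \<le> norm (id_blinfun :: 'a \<Rightarrow>\<^sub>L 'a) / (1 - norm (id_blinfun :: 'a \<Rightarrow>\<^sub>L 'a) * norm (- (s *\<^sub>R B)))"
    using is_inverse_op_perturbation[OF id, of "- (s *\<^sub>R B)"] small by auto
  have "norm (id_blinfun :: 'a \<Rightarrow>\<^sub>L 'a) / (1 - norm (id_blinfun :: 'a \<Rightarrow>\<^sub>L 'a) * norm (- (s *\<^sub>R B))) \<le> 1 / (1 / 2)"
    using le1 small by (intro frac_le) auto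
  with G(2) have "norm G \<le> 1 / (1 / 2)" by (rule order_trans)
  then show thesis using that[of G] G(1) by simp
qed

text \<open>
  The left side of \<open>val\<close> is the generating function \<open>\<Sum> s\<^sup>m \<langle>V B\<^sup>m p, q\<rangle>\<close>. Its coefficients are read
  off one at a time by letting \<open>s \<rightarrow> 0\<close> in \<open>(I - s B)\<^sup>-\<^sup>1 p = p + s B (I - s B)\<^sup>-\<^sup>1 p\<close>: those below
  \<open>n - 1\<close> vanish, and each vanishing coefficient lets a factor \<open>s\<close> be cancelled.
\<close>

lemma resolvent_coefficient:
  fixes B V :: "'a::chilbert_space \<Rightarrow>\<^sub>L 'a"
  assumes n: "n \<ge> 1" and \<delta>: "\<delta> > 0"
    and G: "\<And>s. 0 < s \<Longrightarrow> s < \<delta> \<Longrightarrow> is_inverse_op (id_blinfun - s *\<^sub>R B) (G s)"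
    and val: "\<And>s. 0 < s \<Longrightarrow> s < \<delta> \<Longrightarrow>
      cinner (blinfun_apply V (blinfun_apply (G s) p)) q = of_real (s ^ (n - 1) / (1 - s ^ n))"
  shows "cinner (blinfun_apply V ((blinfun_apply B ^^ (n - 1)) p)) q = 1"
proof -
  define g where "g m s = cinner (blinfun_apply V ((blinfun_apply B ^^ m) (blinfun_apply (G s) p))) q" for m s
  define b where "b m = cinner (blinfun_apply V ((blinfun_apply B ^^ m) p)) q" for m
  have pos: "\<forall>\<^sub>F s in at_right (0::real). 0 < s" by (rule eventually_at_right_less)
  have small: "\<forall>\<^sub>F s in at_right (0::real). s < \<delta>" by (rule order_tendstoD(2)[OF tendsto_ident_at \<delta>])
  have Bpow: "bounded_linear (blinfun_apply B ^^ m)" for m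
    by (induction m) (auto intro: bounded_linear_compose[OF blinfun.bounded_linear_right]
        simp: o_def id_def bounded_linear_ident)
  have step: "blinfun_apply (G s) p = p + s *\<^sub>R blinfun_apply B (blinfun_apply (G s) p)"
    if "0 < s" "s < \<delta>" for s
  proof -
    have "blinfun_apply (G s) p - s *\<^sub>R blinfun_apply B (blinfun_apply (G s) p) = p"
      using G[OF that] by (simp add: is_inverse_op_iff blinfun.diff_left blinfun.scaleR_left)
    then show ?thesis by (simp add: algebra_simps)
  qed
  have rec: "g m s = b m + of_real s * g (Suc m) s" if "0 < s" "s < \<delta>" for m s
  proof -
    interpret P: bounded_linear "blinfun_apply B ^^ m" by (rule Bpow)
    have "g m s = cinner (blinfun_apply V ((blinfun_apply B ^^ m) (p + s *\<^sub>R blinfun_apply B (blinfun_apply (G s) p)))) q"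
      unfolding g_def using step[OF that] by simp
    also have "\<dots> = b m + of_real s * g (Suc m) s"
      by (simp add: P.add P.scaleR blinfun.add_right blinfun.scaleR_right cinner_add_left b_def g_def
          bounded_bilinear.scaleR_left[OF bounded_bilinear_cinner] scaleR_conv_of_real funpow_swap1)
    finally show ?thesis .
  qed
  have Glim: "((\<lambda>s. blinfun_apply (G s) p) \<longlongrightarrow> p) (at_right 0)"
  proof (rule LIM_zero_cancel, rule Lim_null_comparison)
    have "((\<lambda>s. s * norm B) \<longlongrightarrow> 0 * norm B) (at_right 0)"
      by (intro tendsto_intros tendsto_ident_at)
    then have "\<forall>\<^sub>F s in at_right 0. s * norm B < 1 / 2" by (rule order_tendstoD) simp
    then show "\<forall>\<^sub>F s in at_right 0. norm (blinfun_apply (G s) p - p) \<le> s * (norm B * (2 * norm p))"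
      using pos small
    proof eventually_elim
      case (elim s)
      obtain G' where "is_inverse_op (id_blinfun - s *\<^sub>R B) G'" "norm G' \<le> 2"
        using neumann_inverse[of s B] elim by auto
      with G[of s] elim have "norm (G s) \<le> 2" using is_inverse_op_unique by blast
      then have "norm (blinfun_apply (G s) p) \<le> 2 * norm p"
        by (meson norm_blinfun order_trans mult_right_mono norm_ge_zero)
      then have "norm (blinfun_apply B (blinfun_apply (G s) p)) \<le> norm B * (2 * norm p)"
        by (meson norm_blinfun order_trans mult_left_mono norm_ge_zero)
      moreover have "blinfun_apply (G s) p - p = s *\<^sub>R blinfun_apply B (blinfun_apply (G s) p)"
        using step[of s] elim by (simp add: algebra_simps)
      ultimately show ?case using elim by (simp add: mult_left_mono)
    qed
    have "((\<lambda>s. s * (norm B * (2 * norm p))) \<longlongrightarrow> 0 * (norm B * (2 * norm p))) (at_right 0)"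
      by (intro tendsto_intros tendsto_ident_at)
    then show "((\<lambda>s. s * (norm B * (2 * norm p))) \<longlongrightarrow> 0) (at_right 0)" by simp
  qed
  have lim: "(g m \<longlongrightarrow> b m) (at_right 0)" for m
    unfolding g_def b_def
    by (intro tendsto_cinner blinfun.tendsto tendsto_const bounded_linear.tendsto[OF Bpow] Glim)
  have power_lim: "((\<lambda>s. of_real (s ^ k / (1 - s ^ n)) :: complex) \<longlongrightarrow> of_real (0 ^ k / (1 - 0 ^ n))) (at_right 0)"
    for k using n by (intro tendsto_intros tendsto_ident_at) (auto simp: power_0_left)
  have vals: "m \<le> n - 1 \<Longrightarrow> \<forall>s. 0 < s \<longrightarrow> s < \<delta> \<longrightarrow> g m s = of_real (s ^ (n - 1 - m) / (1 - s ^ n))" for m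
  proof (induction m)
    case 0
    then show ?case using val by (simp add: g_def)
  next
    case (Suc m)
    then have IH: "g m s = of_real (s ^ (n - 1 - m) / (1 - s ^ n))" if "0 < s" "s < \<delta>" for s
      using that by simp
    have exp: "n - 1 - m = Suc (n - 1 - Suc m)" using Suc.prems by simp
    have "\<forall>\<^sub>F s in at_right 0. of_real (s ^ (n - 1 - m) / (1 - s ^ n)) = g m s"
      using pos small by eventually_elim (simp add: IH)
    then have "(g m \<longlongrightarrow> of_real (0 ^ (n - 1 - m) / (1 - 0 ^ n))) (at_right 0)"
      by (rule Lim_transform_eventually[OF power_lim])
    then have "b m = of_real (0 ^ (n - 1 - m) / (1 - 0 ^ n))"
      using lim[of m] tendsto_unique[OF trivial_limit_at_right_real] by blast
    then have "b m = 0" unfolding exp by simp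
    then have "of_real s * g (Suc m) s = of_real s * of_real (s ^ (n - 1 - Suc m) / (1 - s ^ n))"
      if "0 < s" "s < \<delta>" for s
      using rec[OF that, of m] IH[OF that] unfolding exp by simp
    then show ?case by (metis mult_cancel_left less_irrefl of_real_eq_0_iff)
  qed
  have "\<forall>\<^sub>F s in at_right 0. of_real (s ^ 0 / (1 - s ^ n)) = g (n - 1) s"
    using pos small by eventually_elim (simp add: vals)
  then have "(g (n - 1) \<longlongrightarrow> of_real (0 ^ 0 / (1 - 0 ^ n))) (at_right 0)"
    by (rule Lim_transform_eventually[OF power_lim])
  then have "b (n - 1) = of_real (0 ^ 0 / (1 - 0 ^ n))"
    using lim[of "n - 1"] tendsto_unique[OF trivial_limit_at_right_real] by blast
  then show ?thesis using n by (simp add: b_def power_0_left)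
qed

text \<open>
  Multiplying the singular operator on the right by \<open>G = (I - s B)\<^sup>-\<^sup>1\<close> leaves
  \<open>r(t) T - I + t J(t) G\<close>, a perturbation of \<open>T - I\<close> in the direction \<open>r' T + J0 G\<close>; and
  \<open>\<langle>T p, p\<rangle> = 1\<close>.
\<close>

lemma factored_pencil_first_order:
  fixes T B :: "'a::chilbert_space \<Rightarrow>\<^sub>L 'a" and r :: "real \<Rightarrow> real"
  assumes p: "simple_fixed_vector T p" and T: "clinear_op T" and B: "clinear_op B"
    and J: "\<And>t. clinear_op (J t)" "(J \<longlongrightarrow> J0) (at_right 0)"
    and r: "(r has_real_derivative r') (at 0)" "r 0 = 1"
    and G: "is_inverse_op (id_blinfun - s *\<^sub>R B) G"
    and sing: "\<forall>\<^sub>F t in at_right 0. \<not> invertible_op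
      (((r t *\<^sub>R T - id_blinfun) o\<^sub>L (id_blinfun - s *\<^sub>R B)) + t *\<^sub>R J t)"
  shows "cinner (blinfun_apply J0 (blinfun_apply G p)) p = - of_real r'"
proof -
  have scR: "blinfun_apply X (c *\<^sub>C v) = c *\<^sub>C blinfun_apply X v" if "clinear_op X" for X :: "'a \<Rightarrow>\<^sub>L 'a" and c v
    using that by (rule clinear_op_scaleC)
  have "clinear_op (id_blinfun - s *\<^sub>R B)"
    by (simp add: clinear_op_def blinfun.diff_left blinfun.scaleR_left scR[OF B] scaleC_scaleR
        complex_vector.scale_right_diff_distrib)
  then have Gcl: "clinear_op G" by (rule clinear_op_inverse[OF G])
  define E where "E t = (r t - 1) *\<^sub>R T + t *\<^sub>R (J t o\<^sub>L G)" for t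
  have Ecl: "clinear_op (E t)" for t
    by (simp add: clinear_op_def E_def blinfun.add_left blinfun.scaleR_left scR[OF T] scR[OF J(1)]
        scR[OF Gcl] scaleC_scaleR scaleC_add_right)
  have comp: "(T - id_blinfun + E t) o\<^sub>L (id_blinfun - s *\<^sub>R B)
      = ((r t *\<^sub>R T - id_blinfun) o\<^sub>L (id_blinfun - s *\<^sub>R B)) + t *\<^sub>R J t" for t
  proof (rule blinfun_eqI)
    fix v
    let ?u = "blinfun_apply (id_blinfun - s *\<^sub>R B) v"
    have "blinfun_apply G ?u = v" using G by (simp add: is_inverse_op_iff)
    then have "blinfun_apply (T - id_blinfun + E t) ?u
        = blinfun_apply T ?u - ?u + ((r t - 1) *\<^sub>R blinfun_apply T ?u + t *\<^sub>R blinfun_apply (J t) v)"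
      by (simp only: E_def blinfun.add_left blinfun.diff_left blinfun.scaleR_left blinfun_apply_blinfun_compose
          id_blinfun.rep_eq)
    then show "blinfun_apply ((T - id_blinfun + E t) o\<^sub>L (id_blinfun - s *\<^sub>R B)) v
        = blinfun_apply (((r t *\<^sub>R T - id_blinfun) o\<^sub>L (id_blinfun - s *\<^sub>R B)) + t *\<^sub>R J t) v"
      by (simp only: blinfun.add_left blinfun.diff_left blinfun.scaleR_left blinfun_apply_blinfun_compose
          id_blinfun.rep_eq) (simp add: algebra_simps)
  qed
  have singE: "\<forall>\<^sub>F t in at_right 0. \<not> invertible_op (T - id_blinfun + E t)"
    using sing unfolding comp[symmetric] invertible_op_comp_right_iff[OF G] .
  have "((\<lambda>t. (r (0 + t) - r 0) / t) \<longlongrightarrow> r') (at 0)"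
    using r(1) by (simp add: DERIV_def)
  then have rlim: "((\<lambda>t. (r t - 1) / t) \<longlongrightarrow> r') (at_right 0)"
    using r(2) by (simp add: filterlim_at_split)
  have "((\<lambda>t. ((r t - 1) / t) *\<^sub>R T + (J t o\<^sub>L G)) \<longlongrightarrow> r' *\<^sub>R T + (J0 o\<^sub>L G)) (at_right 0)"
    by (intro tendsto_intros rlim bounded_bilinear.tendsto[OF bounded_bilinear_blinfun_compose] J(2))
  moreover have "\<forall>\<^sub>F t in at_right 0. ((r t - 1) / t) *\<^sub>R T + (J t o\<^sub>L G) = E t /\<^sub>R t"
    using eventually_at_right_less[of 0]
    by eventually_elim (simp add: E_def scaleR_add_right divide_inverse_commute)
  ultimately have "((\<lambda>t. E t /\<^sub>R t) \<longlongrightarrow> r' *\<^sub>R T + (J0 o\<^sub>L G)) (at_right 0)"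
    by (rule Lim_transform_eventually)
  from simple_fixed_vector_first_order[OF p T Ecl singE this]
  have "cinner (blinfun_apply (r' *\<^sub>R T + (J0 o\<^sub>L G)) p) p = 0" .
  moreover have "blinfun_apply T p = p" "cinner p p = 1"
    using p by (auto simp: simple_fixed_vector_def cinner_self)
  ultimately show ?thesis
    by (simp add: blinfun.add_left blinfun.scaleR_left cinner_add_left scaleR_conv_of_real
        bounded_bilinear.scaleR_left[OF bounded_bilinear_cinner] add_eq_0_iff)
qed

text \<open>
  With real parameters \<open>s\<close> and \<open>t\<close> the branch of the surface through \<open>r = 1\<close> is an explicit real
  root.
\<close>

lemma root_family:
  fixes s :: real
  assumes n: "n \<ge> 1" and s: "0 < s" "s < 1"
  defines "r \<equiv> \<lambda>t. root n ((1 - (s + t) ^ n) / (1 - s ^ n))"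
  shows "r 0 = 1"
    and "(r has_real_derivative - (s ^ (n - 1) / (1 - s ^ n))) (at 0)"
    and "\<And>t. 0 < t \<Longrightarrow> s + t < 1 \<Longrightarrow> r t ^ n * (1 - s ^ n) = 1 - (s + t) ^ n"
    and "\<And>t. 0 < t \<Longrightarrow> s + t < 1 \<Longrightarrow> r t > 0"
proof -
  have sn: "1 - s ^ n > 0" using s n by (simp add: power_Suc_less_one power_less_one_iff)
  show r0: "r 0 = 1" using sn n by (simp add: r_def)
  have "((\<lambda>t. (1 - (s + t) ^ n) / (1 - s ^ n)) has_real_derivative - (real n * s ^ (n - 1)) / (1 - s ^ n)) (at 0)"
    using sn by (auto intro!: derivative_eq_intros)
  moreover have "DERIV (root n) ((1 - (s + 0) ^ n) / (1 - s ^ n)) :> inverse (real n)"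
    using DERIV_real_root[of n 1] n sn by simp
  ultimately have "(r has_real_derivative inverse (real n) * (- (real n * s ^ (n - 1)) / (1 - s ^ n))) (at 0)"
    unfolding r_def by (rule DERIV_chain2[rotated])
  then show "(r has_real_derivative - (s ^ (n - 1) / (1 - s ^ n))) (at 0)"
    using n by (simp add: field_simps)
  fix t :: real assume t: "0 < t" "s + t < 1"
  then have "1 - (s + t) ^ n > 0" using s n by (simp add: power_less_one_iff)
  then have q: "(1 - (s + t) ^ n) / (1 - s ^ n) > 0" using sn by simp
  show "r t > 0" using q n by (simp add: r_def)
  show "r t ^ n * (1 - s ^ n) = 1 - (s + t) ^ n"
    unfolding r_def using q n sn by (subst real_root_pow_pos2) auto
qed


lemma pencil_quadruple:
  "pencil [A, B, C, D] (vec_of_list [x, y, z, w]) = scale_op x A + scale_op y B + scale_op z C + scale_op w D"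
proof -
  have "{..<4::nat} = {0, 1, 2, 3}" by auto
  then show ?thesis by (simp add: pencil_def numeral_eq_Suc add.assoc)
qed

lemma polydisk_quadruple:
  "vec_of_list [x, y, z, w] \<in> polydisk (vec_of_list [d, 0, 0, 0]) \<epsilon> \<longleftrightarrow>
     cmod (x - d) < \<epsilon> \<and> cmod y < \<epsilon> \<and> cmod z < \<epsilon> \<and> cmod w < \<epsilon>"
proof -
  have "(\<forall>j<4. P j) \<longleftrightarrow> P 0 \<and> P 1 \<and> P 2 \<and> P (3::nat)" for P
    by (auto simp: less_Suc_eq numeral_eq_Suc)
  moreover have dim: "dim_vec (vec_of_list [a, b, c, e]) = 4" for a b c e :: complex
    by simp
  moreover have "vec_of_list [x, y, z, w] \<in> carrier_vec 4"
    unfolding carrier_vec_def mem_Collect_eq by (rule dim)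
  moreover have "vec_of_list [a, b, c, e] $ 0 = a" "vec_of_list [a, b, c, e] $ 1 = b"
    "vec_of_list [a, b, c, e] $ 2 = c" "vec_of_list [a, b, c, e] $ 3 = e" for a b c e :: complex
    by (simp_all add: numeral_eq_Suc)
  ultimately show ?thesis unfolding polydisk_def by (simp only: mem_Collect_eq diff_zero) simp
qed

lemma cis_root_of_unity: "n \<ge> 1 \<Longrightarrow> cis (2 * pi / n) ^ n = 1"
  by (simp add: Complex.DeMoivre)

text \<open>
  The points \<open>(d r, s + t, - d r s, 0)\<close> and \<open>(d r, s, - d r s, - \<omega> t d r)\<close> turn the pencil into
  \<open>(r T - I) (I - s B)\<close> plus a term of order \<open>t\<close>, where \<open>T = d A\<close>. On the surface \<open>r\<close> depends on
  \<open>t\<close> through \<open>r\<^sup>n (1 - s\<^sup>n) = 1 - (s + t)\<^sup>n\<close> and through the reciprocal relation, respectively.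
\<close>

lemma surface_determines_moments:
  fixes A B :: "'a::chilbert_space \<Rightarrow>\<^sub>L 'a" and n :: nat
  assumes n: "n \<ge> 1" and A: "clinear_op A" and B: "clinear_op B" and d: "d ^ n = 1" and \<epsilon>: "\<epsilon> > 0"
    and sub: "Gamma_set n \<inter> polydisk (vec_of_list [d, 0, 0, 0]) \<epsilon> \<subseteq> sigma_p [A, B, A o\<^sub>L B, B o\<^sub>L A]"
    and p: "simple_fixed_vector (scale_op d A) p"
  shows "cinner ((blinfun_apply B ^^ n) p) p = 1"
    and "cis (2 * pi / n) * d * cinner (blinfun_apply B (blinfun_apply A ((blinfun_apply B ^^ (n - 1)) p))) p = 1"
proof -
  define \<omega> where "\<omega> = cis (2 * pi / n)"
  have \<omega>: "\<omega> ^ n = 1" "cmod \<omega> = 1" using cis_root_of_unity[OF n] by (simp_all add: \<omega>_def)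
  have normd: "cmod d = 1" using power_eq_1_iff[OF d] n by simp
  define T where "T = scale_op d A"
  have T: "clinear_op T"
    using A by (simp add: T_def clinear_op_def scaleC_scaleC mult.commute)
  note pT = p[folded T_def]
  \<comment> \<open>\<open>1 / 2\<close> leaves room for \<open>s + t < 1\<close>, \<open>\<epsilon> / 2\<close> keeps the points in the polydisk as \<open>r < 2\<close>, and
    the last bound gives the Neumann inverse.\<close>
  define \<delta> where "\<delta> = min (1 / 2) (min (\<epsilon> / 2) (1 / (2 * (norm B + 1))))"
  have \<delta>: "\<delta> > 0" using \<epsilon> by (simp add: \<delta>_def add_nonneg_pos)
  define G where "G s = inverse_op (id_blinfun - s *\<^sub>R B)" for s :: real
  have G: "is_inverse_op (id_blinfun - s *\<^sub>R B) (G s)" if "0 < s" "s < \<delta>" for s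
  proof -
    have "norm B + 1 > 0" by (simp add: add_nonneg_pos)
    moreover have "s < 1 / (2 * (norm B + 1))" using that by (simp add: \<delta>_def)
    ultimately have "s * (norm B + 1) \<le> 1 / 2" by (simp add: field_simps)
    then have "s * norm B \<le> 1 / 2" using that by (simp add: distrib_left)
    then have "invertible_op (id_blinfun - s *\<^sub>R B)"
      using neumann_inverse[of s B] that unfolding invertible_op_def by (metis less_imp_le)
    then show ?thesis unfolding G_def by (rule is_inverse_op_inverse_op)
  qed
  have singular: "\<not> invertible_op (scale_op x A + scale_op y B + scale_op z (A o\<^sub>L B) + scale_op w (B o\<^sub>L A) - id_blinfun)"
    if "x ^ n + y ^ n + (-1) ^ (n - 1) * (\<omega> * z + w) ^ n = 1"
      "cmod (x - d) < \<epsilon>" "cmod y < \<epsilon>" "cmod z < \<epsilon>" "cmod w < \<epsilon>" for x y z w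
  proof -
    have "vec_of_list [x, y, z, w] \<in> Gamma_set n"
      unfolding Gamma_set_def \<omega>_def[symmetric] using that(1) by blast
    moreover have "vec_of_list [x, y, z, w] \<in> polydisk (vec_of_list [d, 0, 0, 0]) \<epsilon>"
      using that by (simp only: polydisk_quadruple)
    ultimately have "vec_of_list [x, y, z, w] \<in> sigma_p [A, B, A o\<^sub>L B, B o\<^sub>L A]" using sub by blast
    then show ?thesis unfolding sigma_p_def mem_Collect_eq pencil_quadruple by (rule conjunct2)
  qed
  have sign: "(-1) ^ (n - 1) * (- a) ^ n = - (a ^ n)" for a :: complex
    using n by (cases n) (simp_all add: power_minus[of a])
  have moments: "cinner (blinfun_apply B (blinfun_apply (G s) p)) p = of_real (s ^ (n - 1) / (1 - s ^ n))"
      "cinner (blinfun_apply (scale_op \<omega> (B o\<^sub>L T)) (blinfun_apply (G s) p)) p = of_real (s ^ (n - 1) / (1 - s ^ n))"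
    if s: "0 < s" "s < \<delta>" for s
  proof -
    define r where "r t = root n ((1 - (s + t) ^ n) / (1 - s ^ n))" for t
    define r' where "r' = s ^ (n - 1) / (1 - s ^ n)"
    have s1: "s < 1" "s < 1 / 2" "s < \<epsilon> / 2" using s by (simp_all add: \<delta>_def)
    note r = root_family[OF n s(1) s1(1), folded r_def r'_def]
    have pos: "\<forall>\<^sub>F t in at_right (0::real). 0 < t" by (rule eventually_at_right_less)
    have tsmall: "\<forall>\<^sub>F t in at_right (0::real). t < min (1 / 2) (\<epsilon> / 2)"
      using \<epsilon> by (intro order_tendstoD(2)[OF tendsto_ident_at]) simp
    have "(r \<longlongrightarrow> 1) (at 0)" using DERIV_isCont[OF r(2)] r(1) by (simp add: isCont_def)
    then have rlim: "(r \<longlongrightarrow> 1) (at_right 0)" by (simp add: filterlim_at_split)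
    have ilim: "((\<lambda>t. inverse (r t)) \<longlongrightarrow> 1) (at_right 0)"
      using tendsto_inverse[OF rlim] by simp
    have near: "\<forall>\<^sub>F t in at_right 0. \<bar>f t - 1\<bar> < min 1 \<epsilon>" if "(f \<longlongrightarrow> 1) (at_right 0)" for f :: "real \<Rightarrow> real"
      using tendstoD[OF that, of "min 1 \<epsilon>"] \<epsilon> by (simp add: dist_real_def)
    have normx: "cmod (d * of_real \<rho> - d) < \<epsilon>" "\<bar>\<rho>\<bar> < 2" if "\<bar>\<rho> - 1\<bar> < min 1 \<epsilon>" for \<rho> :: real
    proof -
      have "d * of_real \<rho> - d = d * of_real (\<rho> - 1)" by (simp add: algebra_simps)
      then show "cmod (d * of_real \<rho> - d) < \<epsilon>" using that by (simp only: norm_mult normd norm_of_real) simp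
      show "\<bar>\<rho>\<bar> < 2" using that by linarith
    qed
    have prod_small: "\<bar>\<rho>\<bar> * t < \<epsilon>" if "\<bar>\<rho>\<bar> < 2" "0 < t" "t < \<epsilon> / 2" for \<rho> t :: real
      using mult_strict_right_mono[OF that(1,2)] that(3) by linarith
    have J: "clinear_op (scale_op c (B o\<^sub>L T))" for c
      using B T by (simp add: clinear_op_def scaleC_scaleC mult.commute)
    have "\<forall>\<^sub>F t in at_right 0. \<not> invertible_op
        (((r t *\<^sub>R T - id_blinfun) o\<^sub>L (id_blinfun - s *\<^sub>R B)) + t *\<^sub>R B)"
      using pos tsmall near[OF rlim]
    proof eventually_elim
      case (elim t)
      let ?x = "d * of_real (r t)"
      have st: "s + t < 1" "s + t < \<epsilon>" using elim s1 by auto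
      have "?x ^ n + of_real (s + t) ^ n + (-1) ^ (n - 1) * (\<omega> * (- (?x * of_real s)) + 0) ^ n
          = of_real (r t ^ n * (1 - s ^ n) + (s + t) ^ n)"
        using sign[of "\<omega> * (?x * of_real s)"]
        by (simp add: power_mult_distrib d \<omega> algebra_simps)
      also have "\<dots> = 1" using r(3)[of t] elim st by simp
      finally have "\<not> invertible_op (scale_op ?x A + scale_op (of_real (s + t)) B
          + scale_op (- (?x * of_real s)) (A o\<^sub>L B) + scale_op 0 (B o\<^sub>L A) - id_blinfun)"
        using normx[OF elim(3)] prod_small[of "r t" s] s s1 st elim \<epsilon>
        by (intro singular) (auto simp: norm_mult normd simp del: of_real_add)
      also have "scale_op ?x A + scale_op (of_real (s + t)) B
          + scale_op (- (?x * of_real s)) (A o\<^sub>L B) + scale_op 0 (B o\<^sub>L A) - id_blinfun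
        = ((r t *\<^sub>R T - id_blinfun) o\<^sub>L (id_blinfun - s *\<^sub>R B)) + t *\<^sub>R B"
        by (rule blinfun_eqI)
          (simp add: T_def blinfun.bilinear_simps scaleC_of_real[symmetric] scaleC_scaleC scaleC_add_left
            complex_vector.scale_right_diff_distrib mult_ac clinear_op_scaleC[OF A])
      finally show ?case .
    qed
    from factored_pencil_first_order[OF pT T B B tendsto_const r(2,1) G[OF s] this]
    show "cinner (blinfun_apply B (blinfun_apply (G s) p)) p = of_real (s ^ (n - 1) / (1 - s ^ n))"
      by (simp add: r'_def)
    have "\<forall>\<^sub>F t in at_right 0. \<not> invertible_op
        (((inverse (r t) *\<^sub>R T - id_blinfun) o\<^sub>L (id_blinfun - s *\<^sub>R B))
          + t *\<^sub>R scale_op (- (\<omega> * of_real (inverse (r t)))) (B o\<^sub>L T))"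
      using pos tsmall near[OF ilim]
    proof eventually_elim
      case (elim t)
      let ?x = "d * of_real (inverse (r t))"
      have st: "s + t < 1" "t < \<epsilon> / 2" using elim s1 by auto
      have rt: "r t > 0" using r(4)[of t] elim st by simp
      have arg: "\<omega> * (- (?x * of_real s)) + (- (\<omega> * of_real t * ?x)) = - (\<omega> * ?x * of_real (s + t))"
        by (simp add: algebra_simps)
      have "?x ^ n + of_real s ^ n + (-1) ^ (n - 1) * (\<omega> * (- (?x * of_real s)) + (- (\<omega> * of_real t * ?x))) ^ n
          = of_real (inverse (r t) ^ n * (1 - (s + t) ^ n) + s ^ n)"
        unfolding arg sign by (simp add: power_mult_distrib d \<omega> right_diff_distrib)
      also have "inverse (r t) ^ n * (1 - (s + t) ^ n) = 1 - s ^ n"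
        using r(3)[of t, symmetric] elim st rt by (simp add: power_inverse)
      finally have "\<not> invertible_op (scale_op ?x A + scale_op (of_real s) B
          + scale_op (- (?x * of_real s)) (A o\<^sub>L B) + scale_op (- (\<omega> * of_real t * ?x)) (B o\<^sub>L A) - id_blinfun)"
        using normx[OF elim(3)] prod_small[of "inverse (r t)" s] prod_small[of "inverse (r t)" t] s s1 st elim \<epsilon> rt
        by (intro singular) (auto simp: norm_mult normd \<omega> norm_inverse mult.commute)
      also have "scale_op ?x A + scale_op (of_real s) B
          + scale_op (- (?x * of_real s)) (A o\<^sub>L B) + scale_op (- (\<omega> * of_real t * ?x)) (B o\<^sub>L A) - id_blinfun
        = ((inverse (r t) *\<^sub>R T - id_blinfun) o\<^sub>L (id_blinfun - s *\<^sub>R B))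
          + t *\<^sub>R scale_op (- (\<omega> * of_real (inverse (r t)))) (B o\<^sub>L T)"
        by (rule blinfun_eqI)
          (simp add: T_def blinfun.bilinear_simps scaleC_of_real[symmetric] scaleC_scaleC scaleC_add_left
            complex_vector.scale_right_diff_distrib mult_ac clinear_op_scaleC[OF A] clinear_op_scaleC[OF B])
      finally show ?case .
    qed
    moreover have "((\<lambda>t. scale_op (- (\<omega> * of_real (inverse (r t)))) (B o\<^sub>L T)) \<longlongrightarrow> scale_op (- (\<omega> * of_real 1)) (B o\<^sub>L T)) (at_right 0)"
      by (intro bounded_bilinear.tendsto[OF bounded_bilinear_scale_op] tendsto_intros ilim)
    moreover have "((\<lambda>t. inverse (r t)) has_real_derivative r') (at 0)"
      using DERIV_inverse'[OF r(2)] r(1) by simp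
    ultimately have "cinner (blinfun_apply (scale_op (- (\<omega> * of_real 1)) (B o\<^sub>L T)) (blinfun_apply (G s) p)) p = - of_real r'"
      using r(1) by (intro factored_pencil_first_order[OF pT T B J _ _ _ G[OF s]]) auto
    then show "cinner (blinfun_apply (scale_op \<omega> (B o\<^sub>L T)) (blinfun_apply (G s) p)) p = of_real (s ^ (n - 1) / (1 - s ^ n))"
      by (simp add: r'_def cinner_scaleC_left cinner_minus_left)
  qed
  have "cinner (blinfun_apply B ((blinfun_apply B ^^ (n - 1)) p)) p = 1"
    using n \<delta> G moments(1) by (rule resolvent_coefficient)
  moreover have "Suc (n - 1) = n" using n by simp
  ultimately show "cinner ((blinfun_apply B ^^ n) p) p = 1" by (metis comp_apply funpow.simps(2))
  have "cinner (blinfun_apply (scale_op \<omega> (B o\<^sub>L T)) ((blinfun_apply B ^^ (n - 1)) p)) p = 1"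
    using n \<delta> G moments(2) by (rule resolvent_coefficient)
  then show "cis (2 * pi / n) * d * cinner (blinfun_apply B (blinfun_apply A ((blinfun_apply B ^^ (n - 1)) p))) p = 1"
    by (simp add: \<omega>_def T_def clinear_op_scaleC[OF B] scaleC_scaleC cinner_scaleC_left)
qed


section \<open>The invariant subspace\<close>

lemma orthonormal_independent:
  fixes u :: "nat \<Rightarrow> 'a::complex_inner"
  assumes on: "\<And>i j. i < n \<Longrightarrow> j < n \<Longrightarrow> cinner (u i) (u j) = (if i = j then 1 else 0)"
  shows "complex_vector.independent (u ` {..<n})" and "card (u ` {..<n}) = n"
proof -
  have "inj_on u {..<n}"
  proof (rule inj_onI)
    fix i j assume ij: "i \<in> {..<n}" "j \<in> {..<n}" "u i = u j"
    then have "cinner (u i) (u j) = 1" using on[of j j] by simp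
    then show "i = j" using on[of i j] ij by (auto split: if_splits)
  qed
  then show "card (u ` {..<n}) = n" by (simp add: card_image)
  show "complex_vector.independent (u ` {..<n})"
  proof (rule complex_vector.independent_if_scalars_zero)
    fix f x assume f: "(\<Sum>x\<in>u ` {..<n}. f x *\<^sub>C x) = 0" and x: "x \<in> u ` {..<n}"
    have "cinner y x = (if y = x then 1 else 0)" if "y \<in> u ` {..<n}" for y
      using that x on by (auto split: if_splits)
    then have "(\<Sum>y\<in>u ` {..<n}. f y * cinner y x) = (\<Sum>y\<in>u ` {..<n}. if y = x then f y else 0)"
      by (intro sum.cong) auto
    also have "\<dots> = f x" using x by simp
    also have "(\<Sum>y\<in>u ` {..<n}. f y * cinner y x) = cinner (\<Sum>y\<in>u ` {..<n}. f y *\<^sub>C y) x"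
      by (simp add: cinner_sum_left cinner_scaleC_left)
    finally show "f x = 0" using f by simp
  qed simp
qed

lemma orthonormal_expansion:
  fixes u :: "nat \<Rightarrow> 'a::complex_inner"
  assumes on: "\<And>i j. i < n \<Longrightarrow> j < n \<Longrightarrow> cinner (u i) (u j) = (if i = j then 1 else 0)"
    and v: "v \<in> complex_vector.span (u ` {..<n})"
  shows "v = (\<Sum>k<n. cinner v (u k) *\<^sub>C u k)"
  using v
proof (induction rule: complex_vector.span_induct_alt)
  case base
  show ?case by simp
next
  case (step c x y)
  then obtain i where i: "i < n" "x = u i" by auto
  have "(\<Sum>k<n. cinner (c *\<^sub>C x + y) (u k) *\<^sub>C u k)
      = c *\<^sub>C (\<Sum>k<n. cinner x (u k) *\<^sub>C u k) + (\<Sum>k<n. cinner y (u k) *\<^sub>C u k)"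
    by (simp add: cinner_add_left cinner_scaleC_left scaleC_add_left sum.distrib scaleC_scaleC
        complex_vector.scale_sum_right)
  also have "(\<Sum>k<n. cinner x (u k) *\<^sub>C u k) = (\<Sum>k<n. if k = i then u k else 0)"
    using i on by (intro sum.cong) auto
  also have "\<dots> = x" using i by simp
  finally show ?case using step by simp
qed

lemma orthonormal_cinner:
  fixes u :: "nat \<Rightarrow> 'a::complex_inner"
  assumes on: "\<And>i j. i < n \<Longrightarrow> j < n \<Longrightarrow> cinner (u i) (u j) = (if i = j then 1 else 0)"
    and v: "v \<in> complex_vector.span (u ` {..<n})"
  shows "cinner v w = (\<Sum>k<n. cinner v (u k) * cinner (u k) w)"
  by (subst orthonormal_expansion[OF on v]) (simp_all add: cinner_sum_left cinner_scaleC_left)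

lemma roots_of_unity_distinct:
  fixes i j n :: nat
  assumes "i < n" "j < n" "cis (2 * pi / n) ^ i = cis (2 * pi / n) ^ j"
  shows "i = j"
proof -
  have "inj_on (\<lambda>k. cis (2 * pi * real k / real n)) {..<n}"
    using Complex.bij_betw_roots_unity[of n] assms(1) by (simp add: bij_betw_def)
  moreover have "cis (2 * pi / n) ^ k = cis (2 * pi * real k / real n)" for k
    by (simp add: Complex.DeMoivre mult.commute)
  ultimately show ?thesis using assms by (auto dest: inj_onD)
qed

text \<open>
  The operators \<open>(1/n) \<Sum> (\<omega>\<^sup>-\<^sup>j B)\<^sup>m\<close> project a vector fixed by \<open>B\<^sup>n\<close> onto its components in the
  eigenspaces of \<open>B\<close>.
\<close>

lemma fixed_by_power_decomposition:
  fixes B :: "'a::complex_inner \<Rightarrow>\<^sub>L 'a"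
  assumes n: "n \<ge> 1" and B: "clinear_op B" and e: "(blinfun_apply B ^^ n) e = e"
  obtains \<zeta> where "\<And>j. blinfun_apply B (\<zeta> j) = cis (2 * pi / n) ^ j *\<^sub>C \<zeta> j" "e = (\<Sum>j<n. \<zeta> j)"
proof -
  define \<omega> where "\<omega> = cis (2 * pi / n)"
  have \<omega>: "\<omega> ^ n = 1" "\<omega> \<noteq> 0" using cis_root_of_unity[OF n] by (simp_all add: \<omega>_def)
  define \<zeta> where "\<zeta> j = (\<Sum>m<n. (inverse (\<omega> ^ j) ^ m / of_nat n) *\<^sub>C (blinfun_apply B ^^ m) e)" for j
  show thesis
  proof
    fix j
    define f where "f m = (\<omega> ^ j * (inverse (\<omega> ^ j) ^ m / of_nat n)) *\<^sub>C (blinfun_apply B ^^ m) e" for m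
    have "\<omega> ^ j * (inverse (\<omega> ^ j) ^ Suc m / of_nat n) = inverse (\<omega> ^ j) ^ m / of_nat n" for m
      using \<omega>(2) by (simp add: field_simps)
    then have "blinfun_apply B (\<zeta> j) = (\<Sum>m<n. f (Suc m))"
      unfolding \<zeta>_def f_def by (simp only: blinfun.sum_right clinear_op_scaleC[OF B] funpow.simps comp_apply)
    also have "f n = f 0"
    proof -
      have "inverse (\<omega> ^ j) ^ n = inverse ((\<omega> ^ n) ^ j)" by (simp add: power_inverse power_mult[symmetric] mult.commute)
      then show ?thesis by (simp add: f_def e \<omega>)
    qed
    then have "(\<Sum>m<n. f (Suc m)) = (\<Sum>m<n. f m)"
      using sum.lessThan_Suc_shift[of f n] sum.lessThan_Suc[of f n] by simp
    also have "\<dots> = \<omega> ^ j *\<^sub>C \<zeta> j"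
      by (simp add: \<zeta>_def f_def complex_vector.scale_sum_right scaleC_scaleC)
    finally show "blinfun_apply B (\<zeta> j) = cis (2 * pi / n) ^ j *\<^sub>C \<zeta> j" by (simp add: \<omega>_def)
  next
    have "(\<Sum>j<n. inverse (\<omega> ^ j) ^ m / of_nat n) = (if m = 0 then 1 else 0)" if "m < n" for m
    proof (cases "m = 0")
      case False
      have eq: "inverse (\<omega> ^ j) ^ m = inverse (\<omega> ^ m) ^ j" for j
        by (simp add: power_inverse power_mult[symmetric] mult.commute)
      have "\<omega> ^ m \<noteq> 1" using roots_of_unity_distinct[of m n 0] that n False by (auto simp: \<omega>_def)
      then have "inverse (\<omega> ^ m) \<noteq> 1" by (metis inverse_1 inverse_inverse_eq)
      moreover have "inverse (\<omega> ^ m) ^ n = 1"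
        unfolding eq[symmetric] by (simp add: \<omega>)
      ultimately have "(\<Sum>j<n. inverse (\<omega> ^ m) ^ j) = 0" by (simp add: geometric_sum)
      then show ?thesis using False by (simp only: eq flip: sum_divide_distrib) simp
    qed (use n in simp)
    then have "(\<Sum>m<n. (\<Sum>j<n. inverse (\<omega> ^ j) ^ m / of_nat n) *\<^sub>C (blinfun_apply B ^^ m) e)
        = (\<Sum>m<n. if m = 0 then e else 0)"
      by (intro sum.cong) auto
    also have "\<dots> = e" using n by simp
    finally show "e = (\<Sum>j<n. \<zeta> j)"
      unfolding \<zeta>_def by (subst sum.swap) (simp add: complex_vector.scale_sum_left)
  qed
qed

lemma norm_power_contraction:
  fixes B :: "'a::real_normed_vector \<Rightarrow>\<^sub>L 'a"
  assumes "norm B \<le> 1"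
  shows "norm ((blinfun_apply B ^^ m) v) \<le> norm v"
proof (induction m)
  case (Suc m)
  let ?w = "(blinfun_apply B ^^ m) v"
  have "norm (blinfun_apply B ?w) \<le> norm B * norm ?w" by (rule norm_blinfun)
  also have "\<dots> \<le> 1 * norm ?w" by (rule mult_right_mono[OF assms]) simp
  finally have "norm (blinfun_apply B ?w) \<le> norm ?w" by simp
  with Suc show ?case by simp
qed simp

text \<open>
  Each \<open>e\<close> is fixed by \<open>B\<^sup>n\<close>, hence a combination of the at most \<open>n\<close> eigenvectors \<open>q\<close>. As the
  \<open>e\<close> are \<open>n\<close> independent vectors, both families span the same \<open>n\<close>-dimensional space, which is
  invariant under \<open>B\<close> and on which \<open>A\<close> is unitary. There \<open>f = B\<^sup>n\<^sup>-\<^sup>1 e\<close>, the preimage of the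
  eigenvector \<open>e\<close> for \<open>\<omega> ^ Suc j\<close>, has \<open>\<langle>A f, f\<rangle> = \<langle>B A f, e\<rangle> = \<omega>\<^sup>j\<close> by the second moment
  condition; being extremal, it is an eigenvector of \<open>A\<close>. So \<open>B\<close> moves eigenvectors of \<open>A\<close> from
  \<open>\<omega>\<^sup>j\<close> to \<open>\<omega> ^ Suc j\<close>, and the orbit of one of them is the required basis.
\<close>

lemma clock_shift_orbit:
  fixes A B :: "'a::complex_inner \<Rightarrow>\<^sub>L 'a" and n :: nat and e q :: "nat \<Rightarrow> 'a"
  defines "\<omega> \<equiv> cis (2 * pi / n)"
  assumes n: "n \<ge> 1" and A: "clinear_op A" "normal_op A" and B: "clinear_op B" "norm B \<le> 1"
    and e: "\<And>j. norm (e j) = 1" "\<And>j. blinfun_apply A (e j) = \<omega> ^ j *\<^sub>C e j"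
    and simpleA: "\<And>j v. blinfun_apply A v = \<omega> ^ j *\<^sub>C v \<Longrightarrow> v = cinner v (e j) *\<^sub>C e j"
    and q: "\<And>j. blinfun_apply B (q j) = \<omega> ^ j *\<^sub>C q j"
    and simpleB: "\<And>j v. blinfun_apply B v = \<omega> ^ j *\<^sub>C v \<Longrightarrow> \<exists>c. v = c *\<^sub>C q j"
    and mom1: "\<And>j. cinner ((blinfun_apply B ^^ n) (e j)) (e j) = 1"
    and mom2: "\<And>j. \<omega> * cinner (blinfun_apply B (blinfun_apply A ((blinfun_apply B ^^ (n - 1)) (e j)))) (e j) = \<omega> ^ j"
  obtains u where "\<And>i j. i < n \<Longrightarrow> j < n \<Longrightarrow> cinner (u i) (u j) = (if i = j then 1 else 0)"
    "\<And>j. blinfun_apply A (u j) = \<omega> ^ j *\<^sub>C u j"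
    "\<And>j. blinfun_apply B (u j) = u (Suc j)" "u n = u 0"
proof -
  have \<omega>: "\<omega> \<noteq> 0" "cmod \<omega> = 1" by (simp_all add: \<omega>_def)
  have adj: "cinner (blinfun_apply A v) (e j) = \<omega> ^ j * cinner v (e j)" for v j
    by (rule normal_op_eigenvector[OF A(2,1) e(2)])
  have orth: "cinner v w = 0"
    if "i < n" "j < n" "i \<noteq> j" "blinfun_apply A v = \<omega> ^ i *\<^sub>C v" "blinfun_apply A w = \<omega> ^ j *\<^sub>C w" for i j v w
  proof -
    have "\<omega> ^ i * cinner v w = \<omega> ^ j * cinner v w"
      using normal_op_eigenvector[OF A(2,1) that(5), of v] by (simp add: that(4) cinner_scaleC_left)
    moreover have "\<omega> ^ i \<noteq> \<omega> ^ j" using roots_of_unity_distinct that(1-3) unfolding \<omega>_def by blast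
    ultimately show ?thesis by simp
  qed
  have e_on: "cinner (e i) (e j) = (if i = j then 1 else 0)" if "i < n" "j < n" for i j
    using orth[OF that _ e(2) e(2)] e(1)[of i] by (auto simp: cinner_self)
  have Bn: "(blinfun_apply B ^^ n) (e j) = e j" for j
    using cinner_extremal[OF mom1] norm_power_contraction[OF B(2), of n "e j"] e(1)[of j] by simp
  let ?E = "complex_vector.span (e ` {..<n})" and ?Q = "complex_vector.span (q ` {..<n})"
  have eQ: "e j \<in> ?Q" for j
  proof -
    obtain \<zeta> where \<zeta>: "\<And>k. blinfun_apply B (\<zeta> k) = \<omega> ^ k *\<^sub>C \<zeta> k" "e j = (\<Sum>k<n. \<zeta> k)"
      using fixed_by_power_decomposition[OF n B(1) Bn[of j]] unfolding \<omega>_def by metis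
    have "\<zeta> k \<in> ?Q" if k: "k < n" for k
    proof -
      have "q k \<in> ?Q" using k by (intro complex_vector.span_base) simp
      moreover obtain c where "\<zeta> k = c *\<^sub>C q k" using simpleB[OF \<zeta>(1)] by blast
      ultimately show ?thesis using complex_vector.span_scale by metis
    qed
    then show ?thesis unfolding \<zeta>(2) by (intro complex_vector.span_sum) auto
  qed
  have BQ: "blinfun_apply B v \<in> ?Q" if "v \<in> ?Q" for v
    using that
  proof (induction rule: complex_vector.span_induct_alt)
    case base
    show ?case by (simp add: complex_vector.span_zero)
  next
    case (step c x y)
    then obtain i where i: "x = q i" "i < n" by blast
    then have qi: "q i \<in> ?Q" by (intro complex_vector.span_base) blast
    have "blinfun_apply B (c *\<^sub>C x + y) = (c * \<omega> ^ i) *\<^sub>C q i + blinfun_apply B y"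
      by (simp add: i(1) blinfun.add_right clinear_op_scaleC[OF B(1)] q scaleC_scaleC)
    then show ?case
      using complex_vector.span_add[OF complex_vector.span_scale[OF qi] step(2)] by (simp only:)
  qed
  have QE: "?Q \<subseteq> ?E"
  proof
    fix v assume v: "v \<in> ?Q"
    show "v \<in> ?E"
    proof (rule ccontr)
      assume nv: "v \<notin> ?E"
      then have indep: "complex_vector.independent (insert v (e ` {..<n}))"
        using orthonormal_independent(1)[OF e_on] by (intro complex_vector.independent_insertI) auto
      have sub: "insert v (e ` {..<n}) \<subseteq> ?Q" using v eQ by auto
      have "card (insert v (e ` {..<n})) \<le> card (q ` {..<n})"
        using complex_vector.independent_span_bound[OF _ indep sub] by simp
      moreover have "v \<notin> e ` {..<n}" by (rule contra_subsetD[OF complex_vector.span_superset nv])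
      ultimately show False
        using orthonormal_independent(2)[OF e_on] card_image_le[of "{..<n}" q] by simp
    qed
  qed
  have isoA: "norm (blinfun_apply A v) = norm v" if v: "v \<in> ?E" for v
  proof -
    have mem: "blinfun_apply A v \<in> ?E"
      using v
    proof (induction rule: complex_vector.span_induct_alt)
      case base
      show ?case by (simp add: complex_vector.span_zero)
    next
      case (step c x y)
      then obtain i where i: "x = e i" "i < n" by blast
      then have ei: "e i \<in> ?E" by (intro complex_vector.span_base) blast
      have "blinfun_apply A (c *\<^sub>C x + y) = (c * \<omega> ^ i) *\<^sub>C e i + blinfun_apply A y"
        by (simp add: i(1) blinfun.add_right clinear_op_scaleC[OF A(1)] e(2) scaleC_scaleC)
      then show ?case
        using complex_vector.span_add[OF complex_vector.span_scale[OF ei] step(2)] by (simp only:)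
    qed
    have comm: "cinner (e k) w = cnj (cinner w (e k))" for k w by (rule cinner_commute)
    have "cinner (blinfun_apply A v) (blinfun_apply A v)
        = (\<Sum>k<n. cinner (blinfun_apply A v) (e k) * cnj (cinner (blinfun_apply A v) (e k)))"
      using orthonormal_cinner[OF e_on mem, of "blinfun_apply A v"] by (simp only: comm)
    also have "\<dots> = (\<Sum>k<n. cinner v (e k) * cnj (cinner v (e k)))"
    proof (intro sum.cong refl)
      fix k
      have "\<omega> ^ k * cnj (\<omega> ^ k) = 1" using \<omega>(2) complex_norm_square[of "\<omega> ^ k"] by (simp add: norm_power)
      then show "cinner (blinfun_apply A v) (e k) * cnj (cinner (blinfun_apply A v) (e k))
          = cinner v (e k) * cnj (cinner v (e k))"
        unfolding adj complex_cnj_mult by (metis mult.assoc mult.left_commute mult_1)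
    qed
    also have "\<dots> = cinner v v"
      using orthonormal_cinner[OF e_on v, of v] by (simp only: comm)
    finally have "(norm (blinfun_apply A v))\<^sup>2 = (norm v)\<^sup>2"
      unfolding cinner_self of_real_eq_iff .
    then show ?thesis by simp
  qed
  have shift: "blinfun_apply A (blinfun_apply B (e j)) = \<omega> ^ Suc j *\<^sub>C blinfun_apply B (e j)" for j
  proof -
    define f where "f = (blinfun_apply B ^^ (n - 1)) (e (Suc j))"
    have "(blinfun_apply B ^^ m) (e (Suc j)) \<in> ?Q" for m
      by (induction m) (auto intro: BQ eQ)
    then have fE: "f \<in> ?E" using QE by (auto simp: f_def)
    have Bf: "blinfun_apply B f = e (Suc j)"
      using Bn[of "Suc j"] n by (cases n) (simp_all add: f_def)
    have f1: "norm f = 1"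
    proof (rule antisym)
      show "norm f \<le> 1" using norm_power_contraction[OF B(2), of "n - 1" "e (Suc j)"] e(1) by (simp add: f_def)
      show "1 \<le> norm f" using norm_power_contraction[OF B(2), of 1 f] Bf e(1)[of "Suc j"] by simp
    qed
    have "cinner (blinfun_apply A f) f = cinner (blinfun_apply B (blinfun_apply A f)) (e (Suc j))"
      using contraction_cinner_preserved[OF B, of f "blinfun_apply A f"] by (simp add: Bf f1 e(1))
    also have "\<dots> = \<omega> ^ j" using mom2[of "Suc j"] \<omega>(1) by (simp add: f_def)
    finally have "blinfun_apply A f = \<omega> ^ j *\<^sub>C f"
      using isoA[OF fE] f1 \<omega>(2) by (intro cinner_extremal) (simp_all add: norm_power)
    then have "f = cinner f (e j) *\<^sub>C e j" by (rule simpleA)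
    then obtain k where k: "f = k *\<^sub>C e j" by blast
    then have k0: "k \<noteq> 0" using f1 by auto
    have "e (Suc j) = k *\<^sub>C blinfun_apply B (e j)"
      using Bf by (simp add: k clinear_op_scaleC[OF B(1)])
    then have "blinfun_apply B (e j) = inverse k *\<^sub>C e (Suc j)"
      using k0 by (simp add: scaleC_scaleC)
    then show ?thesis by (simp add: clinear_op_scaleC[OF A(1)] e(2) scaleC_scaleC mult.commute)
  qed
  \<comment> \<open>The vectors \<open>B (e j)\<close> and \<open>e (Suc j)\<close> may differ by a phase; taking the orbit of \<open>e 0\<close> removes
    all phases at once, and \<open>B\<^sup>n e\<^sub>0 = e\<^sub>0\<close> closes the cycle.\<close>
  define u where "u j = (blinfun_apply B ^^ j) (e 0)" for j
  have Au: "blinfun_apply A (u j) = \<omega> ^ j *\<^sub>C u j" for j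
  proof (induction j)
    case 0
    show ?case using e(2)[of 0] by (simp add: u_def)
  next
    case (Suc j)
    from simpleA[OF this] obtain k where "u j = k *\<^sub>C e j" by blast
    then have "u (Suc j) = k *\<^sub>C blinfun_apply B (e j)"
      by (simp add: u_def clinear_op_scaleC[OF B(1)])
    then show ?case by (simp only: clinear_op_scaleC[OF A(1)] shift scaleC_scaleC mult.commute)
  qed
  have u1: "norm (u j) = 1" if "j < n" for j
  proof (rule antisym)
    show "norm (u j) \<le> 1" using norm_power_contraction[OF B(2), of j "e 0"] e(1) by (simp add: u_def)
    have "(blinfun_apply B ^^ (n - j)) (u j) = (blinfun_apply B ^^ (n - j + j)) (e 0)"
      by (simp only: u_def funpow_add comp_apply)
    then have "(blinfun_apply B ^^ (n - j)) (u j) = e 0" using that Bn by simp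
    then show "1 \<le> norm (u j)" using norm_power_contraction[OF B(2), of "n - j" "u j"] e(1)[of 0] by simp
  qed
  show thesis
  proof (rule that[of u])
    show "cinner (u i) (u j) = (if i = j then 1 else 0)" if "i < n" "j < n" for i j
      using orth[OF that _ Au Au] u1[OF that(1)] by (auto simp: cinner_self)
  qed (simp_all add: Au, simp_all add: u_def Bn)
qed


section \<open>Representation by clock and shift matrices\<close>

lemma cyclic_successor:
  assumes "\<And>j. blinfun_apply B (u j) = u (Suc j)" "u n = u (0::nat)" "j < n"
  shows "blinfun_apply B (u j) = u ((j + 1) mod n)"
  using assms by (cases "Suc j = n") auto

lemma clock_shift_unitary_equivalence:
  fixes A B :: "'a::complex_inner \<Rightarrow>\<^sub>L 'a"
  assumes A: "clinear_op A" and B: "clinear_op B"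
    and on: "\<And>i j. i < n \<Longrightarrow> j < n \<Longrightarrow> cinner (u i) (u j) = (if i = j then 1 else 0)"
    and Au: "\<And>j. blinfun_apply A (u j) = cis (2 * pi / n) ^ j *\<^sub>C u j"
    and Bu: "\<And>j. j < n \<Longrightarrow> blinfun_apply B (u j) = u ((j + 1) mod n)"
  shows "restriction_unitarily_equivalent n (complex_vector.span (u ` {..<n})) A B (clock_mat n) (shift_mat n)"
proof -
  define U where "U v = (\<Sum>k<n. (v $ k) *\<^sub>C u k)" for v :: "complex vec"
  let ?L = "complex_vector.span (u ` {..<n})"
  have "unitary_onto n ?L U"
    unfolding unitary_onto_def
  proof (intro conjI ballI allI)
    fix v w :: "complex vec" and c assume v: "v \<in> carrier_vec n"
    show "U (c \<cdot>\<^sub>v v) = c *\<^sub>C U v"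
      using v by (simp add: U_def complex_vector.scale_sum_right scaleC_scaleC)
    assume w: "w \<in> carrier_vec n"
    show "U (v + w) = U v + U w"
      using v w by (simp add: U_def scaleC_add_left sum.distrib)
    have "cinner (U v) (U w) = (\<Sum>k<n. \<Sum>l<n. v $ k * (cnj (w $ l) * cinner (u k) (u l)))"
      unfolding U_def cinner_sum_left
      by (simp add: cinner_sum_right cinner_scaleC_left cinner_scaleC_right sum_distrib_left mult_ac)
    also have "\<dots> = (\<Sum>k<n. \<Sum>l<n. if l = k then v $ k * cnj (w $ k) else 0)"
      by (intro sum.cong refl) (simp add: on)
    also have "\<dots> = (\<Sum>k<n. v $ k * cnj (w $ k))" by simp
    also have "\<dots> = v \<bullet>c w"
      using v w by (simp add: scalar_prod_def lessThan_atLeast0)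
    finally show "cinner (U v) (U w) = v \<bullet>c w" .
  next
    show "U ` carrier_vec n = ?L"
    proof
      show "U ` carrier_vec n \<subseteq> ?L"
        by (auto simp: U_def intro!: complex_vector.span_sum complex_vector.span_scale
            intro: complex_vector.span_base)
      show "?L \<subseteq> U ` carrier_vec n"
      proof
        fix x assume "x \<in> ?L"
        from orthonormal_expansion[OF on this] have "x = U (vec n (\<lambda>k. cinner x (u k)))"
          by (simp add: U_def)
        then show "x \<in> U ` carrier_vec n" by (rule image_eqI) simp
      qed
    qed
  qed
  moreover have "blinfun_apply A (U v) = U (clock_mat n *\<^sub>v v)" if v: "v \<in> carrier_vec n" for v
  proof -
    have "(clock_mat n *\<^sub>v v) $ k = cis (2 * pi / n) ^ k * v $ k" if "k < n" for k
    proof -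
      have "(clock_mat n *\<^sub>v v) $ k = (\<Sum>j<n. (if k = j then cis (2 * pi * k / n) else 0) * v $ j)"
        using that v by (simp add: clock_mat_def scalar_prod_def lessThan_atLeast0)
      also have "\<dots> = (\<Sum>j<n. if j = k then cis (2 * pi * k / n) * v $ k else 0)"
        by (intro sum.cong) auto
      finally have "(clock_mat n *\<^sub>v v) $ k = (\<Sum>j<n. if j = k then cis (2 * pi * k / n) * v $ k else 0)" .
      then show ?thesis using that by (simp add: Complex.DeMoivre mult_ac)
    qed
    then show ?thesis
      by (simp add: U_def blinfun.sum_right clinear_op_scaleC[OF A] Au scaleC_scaleC mult.commute)
  qed
  moreover have "blinfun_apply B (U v) = U (shift_mat n *\<^sub>v v)" if v: "v \<in> carrier_vec n" for v
  proof -
    have "(shift_mat n *\<^sub>v v) $ k = (\<Sum>j<n. if k = (j + 1) mod n then v $ j else 0)" if "k < n" for k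
      using that v by (auto simp: shift_mat_def scalar_prod_def lessThan_atLeast0 intro!: sum.cong)
    then have "U (shift_mat n *\<^sub>v v) = (\<Sum>k<n. \<Sum>j<n. if k = (j + 1) mod n then (v $ j) *\<^sub>C u k else 0)"
      unfolding U_def by (auto simp: complex_vector.scale_sum_left intro!: sum.cong)
    also have "\<dots> = (\<Sum>j<n. \<Sum>k<n. if k = (j + 1) mod n then (v $ j) *\<^sub>C u k else 0)"
      by (rule sum.swap)
    also have "\<dots> = (\<Sum>j<n. (v $ j) *\<^sub>C u ((j + 1) mod n))"
      by (intro sum.cong refl) simp
    finally show ?thesis
      by (simp add: U_def blinfun.sum_right clinear_op_scaleC[OF B] Bu)
  qed
  ultimately show ?thesis unfolding restriction_unitarily_equivalent_def by blast
qed

text \<open>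
  In the orbit basis \<open>u\<close> an eigenvector \<open>e\<^sub>r\<close> of \<open>A\<close> is a unimodular multiple of \<open>u\<^sub>r\<close>, while
  \<open>\<langle>u\<^sub>r, \<zeta>\<^sub>j\<rangle>\<close> picks up the factor \<open>\<omega>\<^sup>j\<close> when \<open>r\<close> increases by one, because \<open>B\<close> preserves inner
  products with \<open>\<zeta>\<^sub>j\<close>.
\<close>

lemma clock_shift_transition_matrix:
  fixes A B :: "'a::complex_inner \<Rightarrow>\<^sub>L 'a" and n :: nat
  defines "\<omega> \<equiv> cis (2 * pi / n)"
  assumes n: "n \<ge> 1" and A: "clinear_op A" "normal_op A" and B: "clinear_op B" "norm B \<le> 1"
    and on: "\<And>i j. i < n \<Longrightarrow> j < n \<Longrightarrow> cinner (u i) (u j) = (if i = j then 1 else 0)"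
    and Au: "\<And>j. blinfun_apply A (u j) = \<omega> ^ j *\<^sub>C u j"
    and Bu: "\<And>j. blinfun_apply B (u j) = u (Suc j)"
    and L: "L = complex_vector.span (u ` {..<n})"
    and e: "orthonormal_eigenbasis n L A e" and \<zeta>: "orthonormal_eigenbasis n L B \<zeta>"
    and C: "is_transition_mat n e \<zeta> C"
  shows "\<exists>\<Lambda>\<^sub>1 \<Lambda>\<^sub>2. unimodular_diagonal n \<Lambda>\<^sub>1 \<and> unimodular_diagonal n \<Lambda>\<^sub>2 \<and>
    complex_of_real (sqrt n) \<cdot>\<^sub>m C = \<Lambda>\<^sub>1 * fourier_mat n * \<Lambda>\<^sub>2"
proof -
  have \<omega>pow: "cis (2 * pi * real k / n) = \<omega> ^ k" for k
    by (simp add: \<omega>_def Complex.DeMoivre mult_ac)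
  have norm\<omega>: "cmod (\<omega> ^ k) = 1" for k by (simp add: \<omega>_def norm_power)
  have e_on: "cinner (e i) (e j) = (if i = j then 1 else 0)" if "i < n" "j < n" for i j
    using e that by (auto simp: orthonormal_eigenbasis_def orthonormal_basis_of_def)
  have \<zeta>_on: "cinner (\<zeta> i) (\<zeta> j) = (if i = j then 1 else 0)" if "i < n" "j < n" for i j
    using \<zeta> that by (auto simp: orthonormal_eigenbasis_def orthonormal_basis_of_def)
  have eL: "e j \<in> L" and \<zeta>L: "\<zeta> j \<in> L" if "j < n" for j
    using e \<zeta> that complex_vector.span_base[of "e j" "e ` {..<n}"] complex_vector.span_base[of "\<zeta> j" "\<zeta> ` {..<n}"]
    by (auto simp: orthonormal_eigenbasis_def orthonormal_basis_of_def)
  have Ae: "blinfun_apply A (e j) = \<omega> ^ j *\<^sub>C e j" if "j < n" for j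
    using e that by (simp add: orthonormal_eigenbasis_def \<omega>pow)
  have B\<zeta>: "blinfun_apply B (\<zeta> j) = \<omega> ^ j *\<^sub>C \<zeta> j" if "j < n" for j
    using \<zeta> that by (simp add: orthonormal_eigenbasis_def \<omega>pow)
  define \<alpha> where "\<alpha> r = cinner (e r) (u r)" for r
  define \<beta> where "\<beta> j = cinner (u 0) (\<zeta> j)" for j
  have e_eq: "e r = \<alpha> r *\<^sub>C u r" if r: "r < n" for r
  proof -
    have zero: "cinner (e r) (u k) = 0" if "k < n" "k \<noteq> r" for k
    proof -
      have "\<omega> ^ r * cinner (e r) (u k) = \<omega> ^ k * cinner (e r) (u k)"
        using normal_op_eigenvector[OF A(2,1) Au, of "e r" k] by (simp add: Ae[OF r] cinner_scaleC_left)
      moreover have "\<omega> ^ r \<noteq> \<omega> ^ k" using roots_of_unity_distinct that r unfolding \<omega>_def by blast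
      ultimately show ?thesis by simp
    qed
    have "e r = (\<Sum>k<n. cinner (e r) (u k) *\<^sub>C u k)"
      using eL[OF r] unfolding L by (intro orthonormal_expansion[OF on]) auto
    also have "\<dots> = (\<Sum>k<n. if k = r then \<alpha> r *\<^sub>C u r else 0)"
      by (intro sum.cong refl) (auto simp: \<alpha>_def zero)
    also have "\<dots> = \<alpha> r *\<^sub>C u r" using r by simp
    finally show ?thesis .
  qed
  have norm_eq_1: "norm x = 1" if "cinner x x = 1" for x :: 'a
  proof -
    have "complex_of_real ((norm x)\<^sup>2) = of_real 1" using that by (simp add: cinner_self)
    then have "(norm x)\<^sup>2 = 1\<^sup>2" by (simp only: of_real_eq_iff one_power2)
    then show ?thesis by (rule power2_eq_imp_eq) auto
  qed
  have \<alpha>1: "cmod (\<alpha> r) = 1" if r: "r < n" for r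
    using norm_eq_1[of "e r"] norm_eq_1[of "u r"] e_on[OF r r] on[OF r r] arg_cong[OF e_eq[OF r], of norm]
    by (simp add: norm_scaleC)
  have u\<zeta>: "cinner (u r) (\<zeta> j) = (\<omega> ^ j) ^ r * \<beta> j" if j: "j < n" for r j
  proof (induction r)
    case (Suc r)
    have "cnj (\<omega> ^ j) * cinner (u (Suc r)) (\<zeta> j) = cinner (u r) (\<zeta> j)"
      using contraction_cinner_preserved[OF B, of "\<zeta> j" "u r"]
      by (simp add: Bu B\<zeta>[OF j] norm_scaleC norm\<omega> cinner_scaleC_right)
    moreover have "\<omega> ^ j * cnj (\<omega> ^ j) = 1"
      using complex_norm_square[of "\<omega> ^ j"] norm\<omega>[of j] by simp
    ultimately have "cinner (u (Suc r)) (\<zeta> j) = \<omega> ^ j * cinner (u r) (\<zeta> j)"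
      by (metis mult.assoc mult_1)
    then show ?case by (simp add: Suc mult_ac)
  qed (simp add: \<beta>_def)
  have \<beta>1: "sqrt n * cmod (\<beta> j) = 1" if j: "j < n" for j
  proof -
    have "1 = (\<Sum>k<n. cinner (\<zeta> j) (u k) * cinner (u k) (\<zeta> j))"
      using orthonormal_cinner[OF on \<zeta>L[OF j, unfolded L], of "\<zeta> j"] \<zeta>_on[OF j j] by simp
    also have "\<dots> = (\<Sum>k<n. of_real ((cmod (\<beta> j))\<^sup>2))"
    proof (intro sum.cong refl)
      fix k
      have "cinner (\<zeta> j) (u k) = cnj (cinner (u k) (\<zeta> j))" by (rule cinner_commute)
      then have "cinner (\<zeta> j) (u k) * cinner (u k) (\<zeta> j) = of_real ((cmod (cinner (u k) (\<zeta> j)))\<^sup>2)"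
        by (simp only: complex_norm_square mult.commute)
      also have "cmod (cinner (u k) (\<zeta> j)) = cmod (\<beta> j)"
        by (simp add: u\<zeta>[OF j] norm_mult norm_power \<omega>_def)
      finally show "cinner (\<zeta> j) (u k) * cinner (u k) (\<zeta> j) = of_real ((cmod (\<beta> j))\<^sup>2)" .
    qed
    also have "\<dots> = of_real (real n * (cmod (\<beta> j))\<^sup>2)" by simp
    finally have "real n * (cmod (\<beta> j))\<^sup>2 = 1" by (metis of_real_eq_1_iff)
    then have "(sqrt n * cmod (\<beta> j))\<^sup>2 = 1\<^sup>2" by (simp add: power_mult_distrib)
    then show ?thesis by (rule power2_eq_imp_eq) auto
  qed
  have Cjr: "C $$ (j, r) = \<alpha> r * ((\<omega> ^ j) ^ r * \<beta> j)" if j: "j < n" and r: "r < n" for j r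
  proof -
    have "cinner (e r) (\<zeta> j) = (\<Sum>k<n. C $$ (k, r) * cinner (\<zeta> k) (\<zeta> j))"
      using C r by (simp add: is_transition_mat_def cinner_sum_left cinner_scaleC_left)
    also have "\<dots> = (\<Sum>k<n. if k = j then C $$ (j, r) else 0)"
      using j by (intro sum.cong refl) (auto simp: \<zeta>_on)
    also have "\<dots> = C $$ (j, r)" using j by simp
    finally show ?thesis
      by (subst (asm) e_eq[OF r]) (simp add: cinner_scaleC_left u\<zeta>[OF j])
  qed
  define D where "D f = mat n n (\<lambda>(i, j). if i = j then f i else 0)" for f :: "nat \<Rightarrow> complex"
  have D: "unimodular_diagonal n (D f)" if "\<And>i. i < n \<Longrightarrow> cmod (f i) = 1" for f
    using that by (auto simp: unimodular_diagonal_def D_def diagonal_mat_def)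
  have prod: "(D f * M * D g) $$ (i, j) = f i * M $$ (i, j) * g j"
    if ij: "i < n" "j < n" and M: "M \<in> carrier_mat n n" for f g M i j
  proof -
    have left: "(D f * M) $$ (i, k) = f i * M $$ (i, k)" if "k < n" for k
    proof -
      have "(D f * M) $$ (i, k) = (\<Sum>l<n. (if i = l then f i else 0) * M $$ (l, k))"
        using ij that M by (simp add: D_def scalar_prod_def lessThan_atLeast0)
      also have "\<dots> = (\<Sum>l<n. if l = i then f i * M $$ (i, k) else 0)"
        by (intro sum.cong) auto
      finally have "(D f * M) $$ (i, k) = (\<Sum>l<n. if l = i then f i * M $$ (i, k) else 0)" .
      then show ?thesis using ij by simp
    qed
    have entry: "D g $$ (k, j) = (if k = j then g j else 0)" if "k < n" for k
      using that ij by (simp add: D_def)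
    have "(D f * M * D g) $$ (i, j) = (\<Sum>k<n. (D f * M) $$ (i, k) * D g $$ (k, j))"
      using ij M by (simp add: D_def scalar_prod_def lessThan_atLeast0)
    also have "\<dots> = (\<Sum>k<n. if k = j then f i * M $$ (i, j) * g j else 0)"
      using ij by (intro sum.cong refl) (auto simp: left entry)
    also have "\<dots> = f i * M $$ (i, j) * g j" using ij by simp
    finally show ?thesis .
  qed
  have F: "fourier_mat n \<in> carrier_mat n n" by (simp add: fourier_mat_def)
  have Ccarrier: "C \<in> carrier_mat n n" using C by (simp add: is_transition_mat_def)
  have "complex_of_real (sqrt n) \<cdot>\<^sub>m C = D (\<lambda>j. of_real (sqrt n) * \<beta> j) * fourier_mat n * D \<alpha>"
  proof (rule eq_matI)
    fix i j assume "i < dim_row (D (\<lambda>j. of_real (sqrt n) * \<beta> j) * fourier_mat n * D \<alpha>)"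
      "j < dim_col (D (\<lambda>j. of_real (sqrt n) * \<beta> j) * fourier_mat n * D \<alpha>)"
    then have ij: "i < n" "j < n" by (simp_all add: D_def)
    have "cis (2 * pi * (real j * real i) / n) = (\<omega> ^ i) ^ j"
      using \<omega>pow[of "j * i"] by (simp add: power_mult mult.commute)
    then show "(complex_of_real (sqrt n) \<cdot>\<^sub>m C) $$ (i, j)
        = (D (\<lambda>j. of_real (sqrt n) * \<beta> j) * fourier_mat n * D \<alpha>) $$ (i, j)"
      unfolding prod[OF ij F] using ij Ccarrier by (simp add: Cjr fourier_mat_def mult_ac)
  qed (use Ccarrier in \<open>simp_all add: D_def\<close>)
  moreover have "unimodular_diagonal n (D (\<lambda>j. of_real (sqrt n) * \<beta> j))"
    using \<beta>1 by (intro D) (simp add: norm_mult)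
  moreover have "unimodular_diagonal n (D \<alpha>)" using \<alpha>1 by (rule D)
  ultimately show ?thesis by blast
qed


lemma root_of_unity_index:
  assumes "n \<ge> 1" "c ^ n = (1::complex)"
  obtains j where "j < n" "c = cis (2 * pi * j / n)"
  using Complex.bij_betw_roots_unity[of n] assms unfolding bij_betw_def by auto

theorem theorem1p13:
  fixes A B :: "'a::chilbert_space \<Rightarrow>\<^sub>L 'a" and n :: nat and \<epsilon> :: real
  assumes "n \<ge> 1"
    and "clinear_op A" and "normal_op A"
    and "clinear_op B" and "norm B = 1"
    and "\<epsilon> > 0"
    and "\<And>\<tau> j. j < n \<Longrightarrow> \<tau> \<in> {tau1 n j, tau2 n j} \<Longrightarrow>
           sigma_p [A, B, A o\<^sub>L B, B o\<^sub>L A] \<inter> polydisk \<tau> \<epsilon> = Gamma_set n \<inter> polydisk \<tau> \<epsilon>"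
    and "\<And>\<tau> j x. j < n \<Longrightarrow> \<tau> \<in> {tau1 n j, tau2 n j} \<Longrightarrow> x \<in> Gamma_set n \<inter> polydisk \<tau> \<epsilon> \<Longrightarrow>
           multiplicity_one [A, B, A o\<^sub>L B, B o\<^sub>L A] x"
  shows "\<exists>L. complex_vector.subspace L \<and> complex_vector.dim L = n \<and>
           blinfun_apply A ` L \<subseteq> L \<and> blinfun_apply B ` L \<subseteq> L \<and>
           restriction_unitarily_equivalent n L A B (clock_mat n) (shift_mat n) \<and>
           (\<forall>e \<zeta> C. orthonormal_eigenbasis n L A e \<longrightarrow> orthonormal_eigenbasis n L B \<zeta> \<longrightarrow>
              is_transition_mat n e \<zeta> C \<longrightarrow>
              (\<exists>\<Lambda>\<^sub>1 \<Lambda>\<^sub>2. unimodular_diagonal n \<Lambda>\<^sub>1 \<and> unimodular_diagonal n \<Lambda>\<^sub>2 \<and>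
                 complex_of_real (sqrt n) \<cdot>\<^sub>m C = \<Lambda>\<^sub>1 * fourier_mat n * \<Lambda>\<^sub>2))"
proof -
  note n = assms(1) and A = assms(2) and normal = assms(3) and B = assms(4) and normB = assms(5)
    and \<epsilon> = assms(6) and surface = assms(7) and mult = assms(8)
  define \<omega> where "\<omega> = cis (2 * pi / n)"
  let ?As = "[A, B, A o\<^sub>L B, B o\<^sub>L A]"
  have scale_cl: "clinear_op (scale_op d T)" if "clinear_op T" for d and T :: "'a \<Rightarrow>\<^sub>L 'a"
    using that by (simp add: clinear_op_def scaleC_scaleC mult.commute)
  have pencil1: "pencil ?As (vec_of_list [d, 0, 0, 0]) = scale_op d A" for d
    unfolding pencil_quadruple by (intro blinfun_eqI) (simp add: blinfun.add_left)
  have pencil2: "pencil ?As (vec_of_list [0, d, 0, 0]) = scale_op d B" for d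
    unfolding pencil_quadruple by (intro blinfun_eqI) (simp add: blinfun.add_left)
  have center: "vec_of_list [d, 0, 0, 0] \<in> Gamma_set n" "vec_of_list [0, d, 0, 0] \<in> Gamma_set n" if "d ^ n = 1" for d
    unfolding Gamma_set_def using that n by (auto simp: power_0_left intro!: exI)
  have self: "x \<in> polydisk x \<epsilon>" for x using \<epsilon> by (simp add: polydisk_def)
  have PA: "\<exists>p. simple_fixed_vector (scale_op d A) p"
    and momA: "simple_fixed_vector (scale_op d A) p \<Longrightarrow> cinner ((blinfun_apply B ^^ n) p) p = 1"
    "simple_fixed_vector (scale_op d A) p \<Longrightarrow>
      \<omega> * d * cinner (blinfun_apply B (blinfun_apply A ((blinfun_apply B ^^ (n - 1)) p))) p = 1"
    and PB: "\<exists>p. simple_fixed_vector (scale_op d B) p"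
    if d: "d ^ n = 1" for d p
  proof -
    obtain j where j: "j < n" "d = cis (2 * pi * j / n)" using root_of_unity_index[OF n d] .
    have tau: "tau1 n j = vec_of_list [d, 0, 0, 0]" "tau2 n j = vec_of_list [0, d, 0, 0]"
      by (simp_all add: tau1_def tau2_def j)
    have d0: "d \<noteq> 0" "cmod d = 1" by (simp_all add: j)
    have "multiplicity_one ?As (vec_of_list [d, 0, 0, 0])"
      using mult[OF j(1), of "tau1 n j"] center(1)[OF d] self by (simp add: tau)
    moreover have "cinner (blinfun_apply (scale_op d A) v) q = cinner v q"
      if "blinfun_apply (scale_op d A) q = q" for q v
    proof -
      have "d *\<^sub>C blinfun_apply A q = q" using that by simp
      then have "blinfun_apply A q = inverse d *\<^sub>C q" using d0(1)
        by (metis complex_vector.scale_one left_inverse scaleC_scaleC)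
      from normal_op_eigenvector[OF normal A this, of v] show ?thesis
        using d0(1) by (simp add: cinner_scaleC_left)
    qed
    ultimately show "\<exists>p. simple_fixed_vector (scale_op d A) p"
      using multiplicity_one_simple_fixed_vector[of ?As "vec_of_list [d, 0, 0, 0]"] scale_cl[OF A]
      unfolding pencil1 by metis
    have "multiplicity_one ?As (vec_of_list [0, d, 0, 0])"
      using mult[OF j(1), of "tau2 n j"] center(2)[OF d] self by (simp add: tau)
    moreover have "cinner (blinfun_apply (scale_op d B) v) q = cinner v q"
      if q: "blinfun_apply (scale_op d B) q = q" for q v
    proof -
      have "norm (scale_op d B) \<le> 1" using norm_scale_op_le[of d B] d0 normB by simp
      then show ?thesis using contraction_cinner_preserved[OF scale_cl[OF B], of d q v] q by simp
    qed
    ultimately show "\<exists>p. simple_fixed_vector (scale_op d B) p"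
      using multiplicity_one_simple_fixed_vector[of ?As "vec_of_list [0, d, 0, 0]"] scale_cl[OF B]
      unfolding pencil2 by metis
    have sub: "Gamma_set n \<inter> polydisk (vec_of_list [d, 0, 0, 0]) \<epsilon> \<subseteq> sigma_p ?As"
      using surface[OF j(1), of "tau1 n j"] unfolding tau by blast
    assume p: "simple_fixed_vector (scale_op d A) p"
    show "cinner ((blinfun_apply B ^^ n) p) p = 1"
      "\<omega> * d * cinner (blinfun_apply B (blinfun_apply A ((blinfun_apply B ^^ (n - 1)) p))) p = 1"
      using surface_determines_moments[OF n A B d \<epsilon> sub p] by (simp_all add: \<omega>_def)
  qed
  \<comment> \<open>A singular point with coordinate \<open>d\<close> belongs to the eigenvalue \<open>1 / d\<close>.\<close>
  define d where "d j = inverse (\<omega> ^ j)" for j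
  have dn: "d j ^ n = 1" for j
  proof -
    have "d j ^ n = inverse ((\<omega> ^ n) ^ j)"
      by (simp add: d_def power_inverse power_mult[symmetric] mult.commute)
    then show ?thesis using cis_root_of_unity[OF n] by (simp add: \<omega>_def)
  qed
  have \<omega>0: "\<omega> \<noteq> 0" by (simp add: \<omega>_def)
  obtain e where e: "\<And>j. simple_fixed_vector (scale_op (d j) A) (e j)" using PA[OF dn] by metis
  obtain q where q: "\<And>j. simple_fixed_vector (scale_op (d j) B) (q j)" using PB[OF dn] by metis
  have fixed_iff: "blinfun_apply (scale_op (d j) T) v = v \<longleftrightarrow> blinfun_apply T v = \<omega> ^ j *\<^sub>C v"
    for T :: "'a \<Rightarrow>\<^sub>L 'a" and j v
    using \<omega>0 by (auto simp: d_def scaleC_scaleC) (metis complex_vector.scale_one power_not_zero right_inverse scaleC_scaleC)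
  have mom2: "\<omega> * cinner (blinfun_apply B (blinfun_apply A ((blinfun_apply B ^^ (n - 1)) (e j)))) (e j) = \<omega> ^ j" for j
    using momA(2)[OF dn e, of j] \<omega>0 by (simp add: d_def field_simps)
  obtain u where u: "\<And>i j. i < n \<Longrightarrow> j < n \<Longrightarrow> cinner (u i) (u j) = (if i = j then 1 else 0)"
    "\<And>j. blinfun_apply A (u j) = cis (2 * pi / n) ^ j *\<^sub>C u j"
    "\<And>j. blinfun_apply B (u j) = u (Suc j)" "u n = u 0"
  proof (rule clock_shift_orbit[OF n A normal B, of e q, folded \<omega>_def])
    show "norm B \<le> 1" using normB by simp
    show "norm (e j) = 1" for j using e by (simp add: simple_fixed_vector_def)
    show "blinfun_apply A (e j) = \<omega> ^ j *\<^sub>C e j" for j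
      using e unfolding simple_fixed_vector_def fixed_iff by blast
    show "blinfun_apply B (q j) = \<omega> ^ j *\<^sub>C q j" for j
      using q unfolding simple_fixed_vector_def fixed_iff by blast
    show "v = cinner v (e j) *\<^sub>C e j" if "blinfun_apply A v = \<omega> ^ j *\<^sub>C v" for j v
      using simple_fixed_vector_unique[OF scale_cl[OF A] e] that unfolding fixed_iff by blast
    show "\<exists>c. v = c *\<^sub>C q j" if "blinfun_apply B v = \<omega> ^ j *\<^sub>C v" for j v
      using simple_fixed_vector_unique[OF scale_cl[OF B] q] that unfolding fixed_iff by blast
    show "cinner ((blinfun_apply B ^^ n) (e j)) (e j) = 1" for j by (rule momA(1)[OF dn e])
  qed (use mom2 in \<open>auto simp: \<omega>_def\<close>)
  define L where "L = complex_vector.span (u ` {..<n})"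
  have Bu: "blinfun_apply B (u j) = u ((j + 1) mod n)" if "j < n" for j
    using u(3,4) that by (rule cyclic_successor)
  have invariant: "blinfun_apply T ` L \<subseteq> L"
    if T: "clinear_op T" "\<And>j. j < n \<Longrightarrow> blinfun_apply T (u j) \<in> L" for T
  proof clarify
    fix v assume "v \<in> L"
    then have "v = (\<Sum>k<n. cinner v (u k) *\<^sub>C u k)" unfolding L_def by (intro orthonormal_expansion[OF u(1)]) auto
    then have "blinfun_apply T v = (\<Sum>k<n. cinner v (u k) *\<^sub>C blinfun_apply T (u k))"
      using clinear_op_scaleC[OF T(1)] blinfun.sum_right by (metis (no_types, lifting) sum.cong)
    also have "\<dots> \<in> L"
      using T(2) unfolding L_def by (intro complex_vector.span_sum complex_vector.span_scale) simp
    finally show "blinfun_apply T v \<in> L" .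
  qed
  have uL: "u j \<in> L" if "j < n" for j
    using that unfolding L_def by (intro complex_vector.span_base) simp
  show ?thesis
  proof (intro exI[of _ L] conjI allI impI)
    show "complex_vector.subspace L" by (simp add: L_def)
    show "complex_vector.dim L = n"
      unfolding L_def using orthonormal_independent[OF u(1)]
      by (simp add: complex_vector.dim_span_eq_card_independent del: complex_vector.dim_span)
    show "blinfun_apply A ` L \<subseteq> L"
      using uL by (intro invariant A) (simp add: u(2) L_def complex_vector.span_scale)
    show "blinfun_apply B ` L \<subseteq> L"
      using uL n by (intro invariant B) (simp add: Bu)
    show "restriction_unitarily_equivalent n L A B (clock_mat n) (shift_mat n)"
      unfolding L_def by (rule clock_shift_unitary_equivalence[OF A B u(1,2) Bu])
    show "\<exists>\<Lambda>\<^sub>1 \<Lambda>\<^sub>2. unimodular_diagonal n \<Lambda>\<^sub>1 \<and> unimodular_diagonal n \<Lambda>\<^sub>2 \<and>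
        complex_of_real (sqrt n) \<cdot>\<^sub>m C = \<Lambda>\<^sub>1 * fourier_mat n * \<Lambda>\<^sub>2"
      if "orthonormal_eigenbasis n L A e" "orthonormal_eigenbasis n L B \<zeta>" "is_transition_mat n e \<zeta> C"
      for e \<zeta> C
      using normB that
      by (intro clock_shift_transition_matrix[OF n A normal B _ u(1,2,3) L_def]) auto
  qed
qed

end
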